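(* Let $F_2$ be the free group of rank $2$ and, for a positive integer $k$, let $P_k\subset F_2$ be the subgroup generated by the $k$-th powers of all primitive elements of $F_2$. Then the quotient group $F_2/P_k$ is finite if and only if $k\in\{1,2,3\}$.
   Context: An element of the free group $F_2$ is primitive if it belongs to some two-element generating set of $F_2$ (equivalently, it is the image of a fixed free generator under an automorphism of $F_2$). The subgroup $P_k$ is characteristic, hence normal, in $F_2$. *)

theory Defs
  imports "HOL-Algebra.Generated_Groups"
begin

text \<open>
  The free group on a set, realised by reduced words. The letter \<open>(x, True)\<close> stands for the
  generator \<open>x\<close> and \<open>(x, False)\<close> for its inverse.
\<close>

definition inv_letter :: "'a \<times> bool \<Rightarrow> 'a \<times> bool" where
  "inv_letter l = (fst l, \<not> snd l)"

definition reduced :: "('a \<times> bool) list \<Rightarrow> bool" where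
  "reduced w \<longleftrightarrow> successively (\<lambda>l m. m \<noteq> inv_letter l) w"

fun push :: "'a \<times> bool \<Rightarrow> ('a \<times> bool) list \<Rightarrow> ('a \<times> bool) list" where
  "push l [] = [l]"
| "push l (m # w) = (if m = inv_letter l then w else l # m # w)"

text \<open>
  On reduced words, \<open>foldr push u v\<close> is the reduced form of the concatenation \<open>u @ v\<close>.
\<close>

definition free_group :: "'a set \<Rightarrow> ('a \<times> bool) list monoid" where
  "free_group X =
     \<lparr>carrier = {w. reduced w \<and> fst ` set w \<subseteq> X}, mult = foldr push, one = []\<rparr>"

abbreviation F2 :: "(bool \<times> bool) list monoid" where
  "F2 \<equiv> free_group (UNIV :: bool set)"

definition primitive_elements :: "(bool \<times> bool) list set" where
  "primitive_elements =
     {x. \<exists>S. S \<subseteq> carrier F2 \<and> card S = 2 \<and> x \<in> S \<and> generate F2 S = carrier F2}"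

definition primitive_power_subgroup :: "nat \<Rightarrow> (bool \<times> bool) list set" where
  "primitive_power_subgroup k = generate F2 {x [^]\<^bsub>F2\<^esub> k | x. x \<in> primitive_elements}"


lemma inv_letter_inv_letter [simp]: "inv_letter (inv_letter l) = l"
  by (simp add: inv_letter_def)

lemma fst_inv_letter [simp]: "fst (inv_letter l) = fst l"
  by (simp add: inv_letter_def)

lemma reduced_Nil [simp]: "reduced []"
  by (simp add: reduced_def)

lemma reduced_Cons:
  "reduced (l # w) \<longleftrightarrow> reduced w \<and> (w = [] \<or> hd w \<noteq> inv_letter l)"
  by (cases w) (auto simp: reduced_def)

lemma reduced_push: "reduced w \<Longrightarrow> reduced (push l w)"
  by (cases w) (auto simp: reduced_Cons)

lemma letters_push: "fst ` set (push l w) \<subseteq> insert (fst l) (fst ` set w)"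
  by (cases w) auto

lemma push_push_inv: "reduced w \<Longrightarrow> push l (push (inv_letter l) w) = w"
proof (cases w)
  case (Cons m v)
  then show "reduced w \<Longrightarrow> ?thesis"
    by (cases v) (auto simp: reduced_Cons)
qed simp

lemma push_reduced: "reduced (l # w) \<Longrightarrow> push l w = l # w"
  by (cases w) (auto simp: reduced_Cons)

lemma reduced_foldr_push: "reduced v \<Longrightarrow> reduced (foldr push u v)"
  by (induction u) (auto intro: reduced_push)

lemma letters_foldr_push: "fst ` set (foldr push u v) \<subseteq> fst ` set u \<union> fst ` set v"
proof (induction u)
  case (Cons l u)
  have "fst ` set (foldr push (l # u) v) \<subseteq> insert (fst l) (fst ` set (foldr push u v))"
    using letters_push by simp
  also have "\<dots> \<subseteq> insert (fst l) (fst ` set u \<union> fst ` set v)"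
    using Cons by (rule insert_mono)
  finally show ?case by simp
qed simp

lemma foldr_push_push:
  assumes "reduced w"
  shows "foldr push (push l u) w = push l (foldr push u w)"
proof (cases u)
  case (Cons m v)
  then show ?thesis
    using push_push_inv[OF reduced_foldr_push[OF assms], of l v] by auto
qed simp

lemma foldr_push_assoc:
  "reduced w \<Longrightarrow> foldr push (foldr push u v) w = foldr push u (foldr push v w)"
  by (induction u) (simp_all add: foldr_push_push)

lemma foldr_push_Nil: "reduced u \<Longrightarrow> foldr push u [] = u"
proof (induction u)
  case (Cons l u)
  then show ?case using push_reduced[of l u] by (auto simp: reduced_Cons)
qed simp

lemma foldr_push_left_inverse: "foldr push (map inv_letter (rev u)) u = []"
  by (induction u) simp_all

lemma carrier_free_group:
  "w \<in> carrier (free_group X) \<longleftrightarrow> reduced w \<and> fst ` set w \<subseteq> X"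
  by (simp add: free_group_def)

lemma mult_free_group [simp]: "u \<otimes>\<^bsub>free_group X\<^esub> v = foldr push u v"
  by (simp add: free_group_def)

lemma one_free_group [simp]: "\<one>\<^bsub>free_group X\<^esub> = []"
  by (simp add: free_group_def)

lemma group_free_group: "group (free_group X)"
proof (rule groupI)
  fix u v assume "u \<in> carrier (free_group X)" "v \<in> carrier (free_group X)"
  then show "u \<otimes>\<^bsub>free_group X\<^esub> v \<in> carrier (free_group X)"
    using subset_trans[OF letters_foldr_push[of u v], of X]
    by (simp add: carrier_free_group reduced_foldr_push)
next
  fix u assume u: "u \<in> carrier (free_group X)"
  let ?v = "foldr push (map inv_letter (rev u)) []"
  have "reduced ?v" by (simp add: reduced_foldr_push)
  moreover have "fst ` set ?v \<subseteq> X"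
    using subset_trans[OF letters_foldr_push[of "map inv_letter (rev u)" "[]"], of X] u
    by (simp add: carrier_free_group image_image)
  moreover have "foldr push ?v u = []"
    using u by (simp add: foldr_push_assoc foldr_push_left_inverse carrier_free_group)
  ultimately show "\<exists>v\<in>carrier (free_group X). v \<otimes>\<^bsub>free_group X\<^esub> u = \<one>\<^bsub>free_group X\<^esub>"
    by (auto simp: carrier_free_group)
qed (auto simp: carrier_free_group foldr_push_assoc)

lemma letter_in_carrier: "x \<in> X \<Longrightarrow> [(x, b)] \<in> carrier (free_group X)"
  by (simp add: carrier_free_group reduced_def)

lemma inv_generator:
  assumes "x \<in> X"
  shows "inv\<^bsub>free_group X\<^esub> [(x, True)] = [(x, False)]"
proof -
  interpret group "free_group X" by (rule group_free_group)
  show ?thesis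
    by (rule inv_equality) (use assms in \<open>auto simp: letter_in_carrier inv_letter_def\<close>)
qed

lemma generate_free_group:
  "generate (free_group X) {[(x, True)] | x. x \<in> X} = carrier (free_group X)"
proof
  interpret group "free_group X" by (rule group_free_group)
  let ?S = "{[(x, True)] | x. x \<in> X}"
  show "generate (free_group X) ?S \<subseteq> carrier (free_group X)"
    by (rule generate_incl) (auto simp: letter_in_carrier)
  have "w \<in> generate (free_group X) ?S" if "reduced w" "fst ` set w \<subseteq> X" for w
    using that
  proof (induction w)
    case Nil
    then show ?case using generate.one[of "free_group X" ?S] by simp
  next
    case (Cons l w)
    obtain x b where l: "l = (x, b)" by (cases l)
    have x: "x \<in> X" using Cons.prems l by auto
    have "[(x, True)] \<in> generate (free_group X) ?S"
      using x by (auto intro: generate.incl)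
    moreover have "inv\<^bsub>free_group X\<^esub> [(x, True)] \<in> generate (free_group X) ?S"
      by (rule generate.inv) (use x in auto)
    then have "[(x, False)] \<in> generate (free_group X) ?S"
      by (simp add: inv_generator x)
    ultimately have "[l] \<in> generate (free_group X) ?S"
      using l by (cases b) auto
    moreover have "w \<in> generate (free_group X) ?S"
      using Cons by (auto simp: reduced_Cons)
    ultimately have "[l] \<otimes>\<^bsub>free_group X\<^esub> w \<in> generate (free_group X) ?S"
      by (rule generate.eng)
    then show ?case using push_reduced[OF Cons.prems(1)] by simp
  qed
  then show "carrier (free_group X) \<subseteq> generate (free_group X) ?S"
    by (auto simp: carrier_free_group)
qed

lemma free_group_universal:
  assumes "group G" and f: "f \<in> X \<rightarrow> carrier G"
  shows "\<exists>h\<in>hom (free_group X) G. \<forall>x\<in>X. h [(x, True)] = f x"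
proof -
  interpret group G by fact
  define a where "a = (\<lambda>l. if snd l then f (fst l) else inv\<^bsub>G\<^esub> f (fst l))"
  define h where "h = (\<lambda>w. foldr (\<lambda>l g. a l \<otimes>\<^bsub>G\<^esub> g) w \<one>\<^bsub>G\<^esub>)"
  have a: "a l \<in> carrier G" if "fst l \<in> X" for l
    using that f by (auto simp: a_def)
  have a_inv: "a l \<otimes>\<^bsub>G\<^esub> a (inv_letter l) = \<one>\<^bsub>G\<^esub>" if "fst l \<in> X" for l
  proof -
    have "f (fst l) \<in> carrier G" using that f by auto
    then show ?thesis by (simp add: a_def inv_letter_def)
  qed
  have h_Cons: "h (l # w) = a l \<otimes>\<^bsub>G\<^esub> h w" for l w
    by (simp add: h_def)
  have h: "h w \<in> carrier G" if "fst ` set w \<subseteq> X" for w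
    using that by (induction w) (auto simp: h_def a)
  have h_push: "h (push l w) = a l \<otimes>\<^bsub>G\<^esub> h w" if "fst l \<in> X" "fst ` set w \<subseteq> X" for l w
  proof (cases "\<exists>v. w = inv_letter l # v")
    case True
    then obtain v where v: "w = inv_letter l # v" by blast
    have "a l \<otimes>\<^bsub>G\<^esub> h w = (a l \<otimes>\<^bsub>G\<^esub> a (inv_letter l)) \<otimes>\<^bsub>G\<^esub> h v"
      using that v by (simp add: h_Cons m_assoc a h)
    also have "\<dots> = h v"
      using that v by (simp add: a_inv h)
    finally show ?thesis by (simp add: v)
  next
    case False
    then have "push l w = l # w" by (cases w) auto
    then show ?thesis by (simp add: h_Cons)
  qed
  have h_mult: "h (foldr push u v) = h u \<otimes>\<^bsub>G\<^esub> h v"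
    if "fst ` set u \<subseteq> X" "fst ` set v \<subseteq> X" for u v
    using that
  proof (induction u)
    case Nil
    then show ?case using h by (simp add: h_def)
  next
    case (Cons l u)
    have "fst ` set (foldr push u v) \<subseteq> X"
      using subset_trans[OF letters_foldr_push[of u v], of X] Cons.prems by simp
    then show ?case
      using Cons by (simp add: h_push h_Cons m_assoc a h)
  qed
  have "h \<in> hom (free_group X) G"
    by (rule homI) (auto simp: carrier_free_group h h_mult)
  moreover have "h [(x, True)] = f x" if "x \<in> X" for x
  proof -
    have "f x \<in> carrier G" using that f by auto
    then show ?thesis by (simp add: h_def a_def)
  qed
  ultimately show ?thesis by blast
qed

lemma (in group) inv_mult_cancel:
  assumes "g \<in> carrier G" "y \<in> carrier G"
  shows "inv g \<otimes> (g \<otimes> y) = y" "g \<otimes> (inv g \<otimes> y) = y"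
  using assms by (simp_all flip: m_assoc)

lemma (in group) conjugation_hom:
  assumes "g \<in> carrier G"
  shows "(\<lambda>y. g \<otimes> y \<otimes> inv g) \<in> hom G G"
  by (rule homI) (use assms in \<open>simp_all add: m_assoc inv_mult_cancel\<close>)

lemma (in group) conjugation_image:
  assumes "g \<in> carrier G"
  shows "(\<lambda>y. g \<otimes> y \<otimes> inv g) ` carrier G = carrier G"
proof
  show "carrier G \<subseteq> (\<lambda>y. g \<otimes> y \<otimes> inv g) ` carrier G"
  proof
    fix y assume y: "y \<in> carrier G"
    have "y = g \<otimes> (inv g \<otimes> y \<otimes> g) \<otimes> inv g"
      using assms y by (simp add: m_assoc inv_mult_cancel)
    then show "y \<in> (\<lambda>y. g \<otimes> y \<otimes> inv g) ` carrier G"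
      by (rule image_eqI) (use assms y in simp)
  qed
qed (use assms in auto)

lemma (in group) conjugation_inj:
  assumes "g \<in> carrier G"
  shows "inj_on (\<lambda>y. g \<otimes> y \<otimes> inv g) (carrier G)"
  using assms by (auto intro: inj_onI)

lemma primitive_elements_carrier: "primitive_elements \<subseteq> carrier F2"
  by (auto simp: primitive_elements_def)

lemma primitive_elements_conjugation:
  assumes g: "g \<in> carrier F2" and x: "x \<in> primitive_elements"
  shows "g \<otimes>\<^bsub>F2\<^esub> x \<otimes>\<^bsub>F2\<^esub> inv\<^bsub>F2\<^esub> g \<in> primitive_elements"
proof -
  interpret group F2 by (rule group_free_group)
  obtain S where S: "S \<subseteq> carrier F2" "card S = 2" "x \<in> S" "generate F2 S = carrier F2"
    using x unfolding primitive_elements_def by blast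
  define c where "c = (\<lambda>y. g \<otimes>\<^bsub>F2\<^esub> y \<otimes>\<^bsub>F2\<^esub> inv\<^bsub>F2\<^esub> g)"
  have hom: "c \<in> hom F2 F2" and im: "c ` carrier F2 = carrier F2" and inj: "inj_on c (carrier F2)"
    unfolding c_def using conjugation_hom conjugation_image conjugation_inj g by blast+
  interpret c: group_hom F2 F2 c
    by unfold_locales (rule hom)
  have "generate F2 (c ` S) = carrier F2"
    using c.generate_img[OF S(1)] S(4) im by simp
  moreover have "card (c ` S) = 2"
    using card_image[OF inj_on_subset[OF inj S(1)]] S(2) by simp
  moreover have "c ` S \<subseteq> carrier F2"
    using S(1) im by blast
  moreover have "c x \<in> c ` S"
    using S(3) by blast
  ultimately have "c x \<in> primitive_elements"
    unfolding primitive_elements_def by blast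
  then show ?thesis by (simp only: c_def)
qed

lemma normal_primitive_power_subgroup: "primitive_power_subgroup k \<lhd> F2"
proof -
  interpret group F2 by (rule group_free_group)
  let ?T = "{x [^]\<^bsub>F2\<^esub> k | x. x \<in> primitive_elements}"
  show ?thesis
    unfolding primitive_power_subgroup_def
  proof (rule normal_generateI)
    show "?T \<subseteq> carrier F2" using primitive_elements_carrier by auto
  next
    fix t g assume "t \<in> ?T" and g: "g \<in> carrier F2"
    then obtain x where x: "x \<in> primitive_elements" and t: "t = x [^]\<^bsub>F2\<^esub> k" by blast
    interpret c: group_hom F2 F2 "\<lambda>y. g \<otimes>\<^bsub>F2\<^esub> y \<otimes>\<^bsub>F2\<^esub> inv\<^bsub>F2\<^esub> g"
      by unfold_locales (rule conjugation_hom[OF g])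
    have "g \<otimes>\<^bsub>F2\<^esub> t \<otimes>\<^bsub>F2\<^esub> inv\<^bsub>F2\<^esub> g = (g \<otimes>\<^bsub>F2\<^esub> x \<otimes>\<^bsub>F2\<^esub> inv\<^bsub>F2\<^esub> g) [^]\<^bsub>F2\<^esub> k"
      unfolding t using x primitive_elements_carrier by (intro c.hom_nat_pow) blast
    then show "g \<otimes>\<^bsub>F2\<^esub> t \<otimes>\<^bsub>F2\<^esub> inv\<^bsub>F2\<^esub> g \<in> ?T"
      using primitive_elements_conjugation[OF g x] by blast
  qed
qed

end

theory Submission
  imports Defs Complex_Main "HOL-Algebra.Multiplicative_Group"
begin

text \<open>
  \<^bold>\<open>Exponents up to three.\<close> Let \<open>a\<close>, \<open>b\<close> be the images of the free generators in the quotient. The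
  elements \<open>a\<close>, \<open>b\<close>, \<open>ab\<close>, \<open>ab\<^sup>-\<^sup>1\<close> are images of primitive elements, so their \<open>k\<close>-th powers vanish;
  for \<open>k \<le> 3\<close> this already forces the commutator \<open>c\<close> of \<open>a\<close> and \<open>b\<close> to be central with \<open>c\<^sup>k = 1\<close>, and
  the quotient is a finite Heisenberg-type group whose elements have the normal form \<open>a\<^sup>i b\<^sup>j c\<^sup>l\<close>
  (\<open>heisenberg_if_cubes\<close>, \<open>finite_heisenberg\<close>).

  \<^bold>\<open>Exponents from four on.\<close> The braid group on four strands contains the free group on
  \<open>a = \<sigma>\<^sub>1 \<sigma>\<^sub>3\<^sup>-\<^sup>1\<close> and \<open>b = \<sigma>\<^sub>2 a \<sigma>\<^sub>2\<^sup>-\<^sup>1\<close> as a normal subgroup, on which it acts by conjugation through the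
  automorphisms of determinant \<open>1\<close> on the abelianization. Consequently every primitive element is
  conjugate, inside the braid group, to \<open>\<sigma>\<^sub>1 \<sigma>\<^sub>3\<^sup>-\<^sup>1\<close>. In a representation of the braid group in which the
  commuting elements \<open>\<sigma>\<^sub>1\<close> and \<open>\<sigma>\<^sub>3\<close> have order \<open>k\<close>, the \<open>k\<close>-th powers of all primitive elements
  therefore act trivially (\<open>primitive_power_eq_one\<close>), and it is enough that the image of the free group
  be infinite. Such a representation is the reduced Burau representation on three-dimensional space,
  normalised so that the \<open>\<sigma>\<^sub>i\<close> are reflections with the eigenvalue \<open>z = exp (2 \<pi> i / k)\<close>. The image of
  \<open>abba\<close> has determinant \<open>1\<close>, the eigenvalue \<open>1\<close> and, with \<open>\<theta> = 2 \<pi> / k\<close>, the real trace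
  \<open>3 + 8 sin\<^sup>2 \<theta> cos \<theta>\<close>. For \<open>k > 4\<close> the trace exceeds \<open>3\<close>, so there is an eigenvalue greater than \<open>1\<close>;
  for \<open>k = 4\<close> the trace is \<open>3\<close> and the map is unipotent but not the identity. In both cases the order is
  infinite, as one sees uniformly by following the orbit of one vector (\<open>burau_abba\<close>,
  \<open>infinite_quotient\<close>).

  \<^bold>\<open>All primitive elements at once.\<close> To pass from the two free generators to arbitrary generating pairs
  one needs Nielsen's theorem that every generating pair arises from the basis by elementary
  moves (\<open>nielsen_reduction\<close>). Its proof works with the length of the common prefix of two reduced
  words, which behaves like a Gromov product in a tree: the ultrametric inequality
  \<open>agree_hyperbolic\<close> and the formula \<open>length_inv_mult\<close> carry the cancellation arguments.
\<close>

text \<open>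
  The group laws are to be applied to \<open>F2\<close> by the simplifier before the multiplication is unfolded
  to \<open>foldr push\<close>.
\<close>
declare mult_free_group [simp del] one_free_group [simp del]

section \<open>Common prefixes and the length function\<close>

fun agree :: "'a list \<Rightarrow> 'a list \<Rightarrow> nat" where
  "agree (x # u) (y # v) = (if x = y then Suc (agree u v) else 0)"
| "agree _ _ = 0"

lemma agree_Nil [simp]: "agree [] v = 0" "agree u [] = 0"
  by (cases u; simp)+

lemma agree_commute: "agree u v = agree v u"
  by (induction u v rule: agree.induct) auto

text \<open>
  The ultrametric inequality of a tree: of the three agreements among \<open>u\<close>, \<open>v\<close>, \<open>w\<close> the two smallest
  coincide, so two different ones determine the third.
\<close>
lemma agree_hyperbolic: "min (agree u v) (agree v w) \<le> agree u w"
proof (induction u v arbitrary: w rule: agree.induct)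
  case (1 x u y v)
  then show ?case by (cases w) auto
qed auto

lemma agree_take: "agree u (take n u) = min n (length u)"
  by (induction u arbitrary: n) (auto simp: take_Cons split: nat.splits)

lemma agree_le_length: "agree u v \<le> length v"
  by (induction u v rule: agree.induct) auto

lemma nth_eq_if_less_agree: "i < agree u v \<Longrightarrow> i < length u \<and> i < length v \<and> u ! i = v ! i"
proof (induction u v arbitrary: i rule: agree.induct)
  case (1 x u y v)
  then show ?case by (cases i) (auto split: if_splits)
qed auto

definition word_inv :: "('a \<times> bool) list \<Rightarrow> ('a \<times> bool) list" where
  "word_inv u = map inv_letter (rev u)"

lemma inv_letter_eq_iff [simp]: "inv_letter l = inv_letter m \<longleftrightarrow> l = m"
  by (metis inv_letter_inv_letter)

lemma inv_letter_neq [simp]: "inv_letter l \<noteq> l" "l \<noteq> inv_letter l"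
  by (auto simp: inv_letter_def prod_eq_iff)

lemma reduced_append:
  "reduced (u @ v) \<longleftrightarrow> reduced u \<and> reduced v \<and> (u = [] \<or> v = [] \<or> hd v \<noteq> inv_letter (last u))"
  by (auto simp: reduced_def successively_append_iff)

lemma reduced_word_inv: "reduced u \<Longrightarrow> reduced (word_inv u)"
proof (induction u)
  case (Cons l u)
  then show ?case
    by (cases u) (auto simp: word_inv_def reduced_append reduced_Cons)
qed (simp add: word_inv_def)

lemma foldr_push_reduced: "reduced (u @ v) \<Longrightarrow> foldr push u v = u @ v"
proof (induction u)
  case (Cons l u)
  then show ?case using push_reduced[of l "u @ v"] by (simp add: reduced_Cons)
qed simp

text \<open>
  In \<open>u\<^sup>-\<^sup>1 v\<close> exactly the common prefix cancels, once in each factor.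
\<close>
lemma length_word_inv_mult:
  "reduced u \<Longrightarrow> reduced v \<Longrightarrow>
     length (foldr push (word_inv u) v) + 2 * agree u v = length u + length v"
proof (induction u v rule: agree.induct)
  case (1 x u y v)
  show ?case
  proof (cases "x = y")
    case True
    then show ?thesis using 1 by (simp add: word_inv_def reduced_Cons)
  next
    case False
    have "reduced (word_inv (x # u) @ y # v)"
      using 1 False reduced_word_inv[of "x # u"]
      by (auto simp: reduced_append reduced_Cons[of "inv_letter x"] word_inv_def)
    then show ?thesis
      using False by (subst foldr_push_reduced) (auto simp: word_inv_def)
  qed
next
  case ("2_2" u)
  then show ?case
    by (simp add: foldr_push_Nil reduced_word_inv) (simp add: word_inv_def)
qed (simp_all add: word_inv_def foldr_push_Nil reduced_word_inv)

interpretation F2: group F2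
  by (rule group_free_group)

lemma carrier_F2: "u \<in> carrier F2 \<longleftrightarrow> reduced u"
  by (simp add: carrier_free_group)

lemma inv_F2: "u \<in> carrier F2 \<Longrightarrow> inv\<^bsub>F2\<^esub> u = word_inv u"
  by (rule F2.inv_equality)
    (simp_all add: carrier_F2 reduced_word_inv mult_free_group one_free_group
      foldr_push_left_inverse[folded word_inv_def])

lemma length_inv [simp]: "u \<in> carrier F2 \<Longrightarrow> length (inv\<^bsub>F2\<^esub> u) = length u"
  by (simp add: inv_F2 word_inv_def)

lemma length_inv_mult:
  assumes "u \<in> carrier F2" "v \<in> carrier F2"
  shows "length (inv\<^bsub>F2\<^esub> u \<otimes>\<^bsub>F2\<^esub> v) + 2 * agree u v = length u + length v"
  using assms length_word_inv_mult by (simp add: inv_F2 carrier_F2 mult_free_group)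

lemma length_mult:
  assumes "u \<in> carrier F2" "v \<in> carrier F2"
  shows "length (u \<otimes>\<^bsub>F2\<^esub> v) + 2 * agree (inv\<^bsub>F2\<^esub> u) v = length u + length v"
  using assms length_inv_mult[of "inv\<^bsub>F2\<^esub> u" v] by simp

text \<open>
  If half of \<open>u\<close> cancelled in \<open>u u\<close>, the middle letter of \<open>u\<close> would be its own inverse, or the two middle
  letters would be inverse to each other.
\<close>
lemma agree_inv_self:
  assumes u: "u \<in> carrier F2" "u \<noteq> []"
  shows "2 * agree (inv\<^bsub>F2\<^esub> u) u < length u"
proof (rule ccontr)
  assume "\<not> ?thesis"
  then have le: "length u \<le> 2 * agree (inv\<^bsub>F2\<^esub> u) u" by simp
  define i where "i = (length u - 1) div 2"
  have i: "i < agree (inv\<^bsub>F2\<^esub> u) u" "i < length u"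
    using le u(2) by (cases u; simp add: i_def; linarith)+
  have "u ! i = word_inv u ! i"
    using nth_eq_if_less_agree[OF i(1)] u(1) by (simp add: inv_F2)
  then have *: "u ! i = inv_letter (u ! (length u - Suc i))"
    using i(2) by (simp add: word_inv_def rev_nth)
  show False
  proof (cases "odd (length u)")
    case True
    then have "length u - Suc i = i" by (auto simp: i_def elim!: oddE)
    then show False using * by simp
  next
    case False
    then obtain m where "length u = 2 * m" by auto
    moreover from this obtain j where "m = Suc j" using u(2) by (cases m) auto
    ultimately have "length u - Suc i = Suc i" "Suc i < length u" by (auto simp: i_def)
    moreover have "successively (\<lambda>l m. m \<noteq> inv_letter l) u"
      using u(1) by (simp add: carrier_F2 reduced_def)
    ultimately show False
      using * unfolding successively_conv_nth by (metis inv_letter_inv_letter)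
  qed
qed

section \<open>Nielsen reduction of generating pairs\<close>

text \<open>
  The hypothesis says that in a product of three images of letters the middle factor is not cancelled
  completely. Every factor then leaves at least one letter in any product. The induction adds letters in
  front and carries along how far the word agrees with the inverse of a further letter: by the ultrametric
  inequality this depends on the first letter only, since less than what survives of it is met.
\<close>
lemma length_hom_ge:
  assumes hom: "\<phi> \<in> hom F2 F2"
    and cancel: "\<And>l m n. m \<noteq> inv_letter l \<Longrightarrow> n \<noteq> inv_letter m \<Longrightarrow>
      agree (inv\<^bsub>F2\<^esub> \<phi> [l]) (\<phi> [m]) + agree (inv\<^bsub>F2\<^esub> \<phi> [m]) (\<phi> [n]) < length (\<phi> [m])"
    and w: "w \<in> carrier F2"
  shows "length w \<le> length (\<phi> w)"
proof -
  interpret \<phi>: group_hom F2 F2 \<phi>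
    by unfold_locales (rule hom)
  have letter: "[l] \<in> carrier F2" for l
    by (simp add: carrier_F2 reduced_Cons)
  have main: "agree (inv\<^bsub>F2\<^esub> \<phi> [l]) (\<phi> (m # w)) = agree (inv\<^bsub>F2\<^esub> \<phi> [l]) (\<phi> [m]) \<and>
      Suc (length w) + agree (inv\<^bsub>F2\<^esub> \<phi> [l]) (\<phi> [m]) \<le> length (\<phi> (m # w))"
    if "reduced (l # m # w)" for l m w
    using that
  proof (induction w arbitrary: l m)
    case Nil
    then have "m \<noteq> inv_letter l" by (simp add: reduced_Cons)
    then show ?case using cancel[of m l m] by simp
  next
    case (Cons n w)
    define v where "v = \<phi> [m]"
    define d where "d = agree (inv\<^bsub>F2\<^esub> \<phi> [l]) v"
    define e where "e = agree (inv\<^bsub>F2\<^esub> v) (\<phi> [n])"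
    have v: "v \<in> carrier F2" unfolding v_def using letter by simp
    have nw: "n # w \<in> carrier F2" "reduced (m # n # w)"
      using Cons.prems by (simp_all add: carrier_F2 reduced_Cons)
    have IH: "agree (inv\<^bsub>F2\<^esub> v) (\<phi> (n # w)) = e" "Suc (length w) + e \<le> length (\<phi> (n # w))"
      using Cons.IH[OF nw(2)] by (simp_all add: v_def e_def)
    have "[m] \<otimes>\<^bsub>F2\<^esub> (n # w) = m # n # w"
      using push_reduced[OF nw(2)] by (simp add: mult_free_group)
    then have split: "\<phi> (m # n # w) = v \<otimes>\<^bsub>F2\<^esub> \<phi> (n # w)"
      using \<phi>.hom_mult[OF letter nw(1), of m] by (simp add: v_def)
    have len: "length (\<phi> (m # n # w)) + 2 * e = length v + length (\<phi> (n # w))"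
      using length_mult[OF v \<phi>.hom_closed[OF nw(1)]] IH(1) by (simp add: split)
    have "length (\<phi> (n # w)) + 2 * agree v (\<phi> (m # n # w)) = length v + length (\<phi> (m # n # w))"
      using length_inv_mult[OF v, of "\<phi> (m # n # w)"] v nw(1)
      by (simp add: split F2.inv_mult_cancel)
    then have "agree v (\<phi> (m # n # w)) + e = length v"
      using len by simp
    moreover have "d + e < length v"
      using cancel[of m l n] Cons.prems unfolding d_def e_def v_def by (simp add: reduced_Cons)
    ultimately have "d < agree v (\<phi> (m # n # w))" by simp
    then have "agree (inv\<^bsub>F2\<^esub> \<phi> [l]) (\<phi> (m # n # w)) = d"
      using agree_hyperbolic[of "inv\<^bsub>F2\<^esub> \<phi> [l]" v "\<phi> (m # n # w)"]
        agree_hyperbolic[of "inv\<^bsub>F2\<^esub> \<phi> [l]" "\<phi> (m # n # w)" v]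
      by (simp add: d_def agree_commute min_def split: if_splits)
    then show ?case
      using len IH(2) \<open>d + e < length v\<close> unfolding d_def v_def by simp
  qed
  show ?thesis
  proof (cases w)
    case (Cons m w')
    then have "reduced (m # m # w')"
      using w by (simp add: carrier_F2 reduced_Cons)
    then show ?thesis using main[of m m w'] Cons by simp
  qed simp
qed

text \<open>
  Besides the usual Nielsen moves, simultaneous conjugation is admitted. In this way reduction needs no
  ordering of words of equal length (see \<open>half_cancelling_conj\<close>).
\<close>
definition nielsen_closed ::
    "((bool \<times> bool) list \<Rightarrow> (bool \<times> bool) list \<Rightarrow> bool) \<Rightarrow> bool" where
  "nielsen_closed P \<longleftrightarrow> (\<forall>u\<in>carrier F2. \<forall>v\<in>carrier F2. P u v \<longrightarrow>
     P v u \<and> P u (inv\<^bsub>F2\<^esub> v) \<and> P u (u \<otimes>\<^bsub>F2\<^esub> v) \<and>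
     (\<forall>g\<in>carrier F2. P (g \<otimes>\<^bsub>F2\<^esub> u \<otimes>\<^bsub>F2\<^esub> inv\<^bsub>F2\<^esub> g) (g \<otimes>\<^bsub>F2\<^esub> v \<otimes>\<^bsub>F2\<^esub> inv\<^bsub>F2\<^esub> g)))"

context
  fixes P
  assumes P: "nielsen_closed P"
begin

lemma nielsen_swap: "u \<in> carrier F2 \<Longrightarrow> v \<in> carrier F2 \<Longrightarrow> P u v \<longleftrightarrow> P v u"
  using P unfolding nielsen_closed_def by blast

lemma nielsen_inv:
  assumes "u \<in> carrier F2" "v \<in> carrier F2"
  shows "P u (inv\<^bsub>F2\<^esub> v) \<longleftrightarrow> P u v" "P (inv\<^bsub>F2\<^esub> u) v \<longleftrightarrow> P u v"
proof -
  have *: "P u (inv\<^bsub>F2\<^esub> v) \<longleftrightarrow> P u v" if "u \<in> carrier F2" "v \<in> carrier F2" for u v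
    using P that unfolding nielsen_closed_def by (metis F2.inv_closed F2.inv_inv)
  show "P u (inv\<^bsub>F2\<^esub> v) \<longleftrightarrow> P u v" "P (inv\<^bsub>F2\<^esub> u) v \<longleftrightarrow> P u v"
    using *[of u v] *[of v u] assms nielsen_swap by auto
qed

lemma nielsen_mult:
  assumes "u \<in> carrier F2" "v \<in> carrier F2"
  shows "P u (u \<otimes>\<^bsub>F2\<^esub> v) \<longleftrightarrow> P u v"
proof -
  have *: "P u v \<Longrightarrow> P u (u \<otimes>\<^bsub>F2\<^esub> v)" if "u \<in> carrier F2" "v \<in> carrier F2" for u v
    using P that unfolding nielsen_closed_def by blast
  have "P u v" if "P u (u \<otimes>\<^bsub>F2\<^esub> v)"
    using *[of "inv\<^bsub>F2\<^esub> u" "u \<otimes>\<^bsub>F2\<^esub> v"] that assms by (simp add: nielsen_inv F2.inv_mult_cancel)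
  then show ?thesis using *[OF assms] by blast
qed

lemma nielsen_conj:
  assumes "u \<in> carrier F2" "v \<in> carrier F2" "g \<in> carrier F2"
  shows "P (inv\<^bsub>F2\<^esub> g \<otimes>\<^bsub>F2\<^esub> u \<otimes>\<^bsub>F2\<^esub> g) (inv\<^bsub>F2\<^esub> g \<otimes>\<^bsub>F2\<^esub> v \<otimes>\<^bsub>F2\<^esub> g) \<longleftrightarrow> P u v"
proof -
  have *: "P (g \<otimes>\<^bsub>F2\<^esub> u \<otimes>\<^bsub>F2\<^esub> inv\<^bsub>F2\<^esub> g) (g \<otimes>\<^bsub>F2\<^esub> v \<otimes>\<^bsub>F2\<^esub> inv\<^bsub>F2\<^esub> g)"
    if "P u v" "u \<in> carrier F2" "v \<in> carrier F2" "g \<in> carrier F2" for u v g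
    using P that unfolding nielsen_closed_def by blast
  show ?thesis
    using *[of u v "inv\<^bsub>F2\<^esub> g"] *[of "inv\<^bsub>F2\<^esub> g \<otimes>\<^bsub>F2\<^esub> u \<otimes>\<^bsub>F2\<^esub> g" "inv\<^bsub>F2\<^esub> g \<otimes>\<^bsub>F2\<^esub> v \<otimes>\<^bsub>F2\<^esub> g" g] assms
    by (auto simp: F2.m_assoc F2.inv_mult_cancel)
qed

lemma nielsen_letters:
  assumes hom: "\<phi> \<in> hom F2 F2" and lm: "fst l \<noteq> fst m"
  shows "P (\<phi> [l]) (\<phi> [m]) \<longleftrightarrow> P (\<phi> [(True, True)]) (\<phi> [(False, True)])"
proof -
  interpret \<phi>: group_hom F2 F2 \<phi>
    by unfold_locales (rule hom)
  have letter: "[l] \<in> carrier F2" for l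
    by (simp add: carrier_F2 reduced_Cons)
  have "\<phi> [(x, False)] = inv\<^bsub>F2\<^esub> \<phi> [(x, True)]" for x
    using \<phi>.hom_inv[OF letter[of "(x, True)"]] inv_generator[of x UNIV] by simp
  then show ?thesis
    using lm letter nielsen_swap[of "\<phi> [(True, True)]" "\<phi> [(False, True)]"]
    by (cases l; cases m; cases "fst l"; cases "snd l"; cases "snd m") (auto simp: nielsen_inv)
qed

end


text \<open>
  The obstinate case of Nielsen reduction: in \<open>u v u\<close> the factor \<open>v = p q\<close> cancels completely, half
  against each neighbour, although no product is shorter than its factors. Then \<open>u = q\<^sup>-\<^sup>1 m p\<^sup>-\<^sup>1\<close>, and
  conjugating the pair \<open>(v, v u) = (p q, p m p\<^sup>-\<^sup>1)\<close> by \<open>p\<close> gives the shorter pair \<open>(q p, m)\<close>.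
\<close>
lemma half_cancelling_conj:
  assumes u: "u \<in> carrier F2" and v: "v \<in> carrier F2" and le: "length v \<le> length u"
    and left: "2 * agree (inv\<^bsub>F2\<^esub> u) v = length v"
    and right: "2 * agree (inv\<^bsub>F2\<^esub> v) u = length v"
  defines "p \<equiv> take (length v div 2) v"
  shows "p \<in> carrier F2"
    and "length (inv\<^bsub>F2\<^esub> p \<otimes>\<^bsub>F2\<^esub> v \<otimes>\<^bsub>F2\<^esub> p) +
      length (inv\<^bsub>F2\<^esub> p \<otimes>\<^bsub>F2\<^esub> (v \<otimes>\<^bsub>F2\<^esub> u) \<otimes>\<^bsub>F2\<^esub> p) \<le> length u"
proof -
  have "reduced (p @ drop (length v div 2) v)"
    using v by (simp add: p_def carrier_F2)
  then show p: "p \<in> carrier F2"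
    by (simp only: carrier_F2 reduced_append)
  define h where "h = length v div 2"
  have h: "length v = 2 * h" "length p = h"
    using left[symmetric] by (simp_all add: h_def p_def)
  define q where "q = inv\<^bsub>F2\<^esub> p \<otimes>\<^bsub>F2\<^esub> v"
  have q: "q \<in> carrier F2" using p v by (simp add: q_def)
  have vp: "agree v p = h"
    using h by (simp add: p_def agree_take)
  have lq: "length q = h"
    using length_inv_mult[OF p v] h vp by (simp add: q_def agree_commute)
  have up: "agree (inv\<^bsub>F2\<^esub> u) p = h"
  proof (rule antisym)
    show "h \<le> agree (inv\<^bsub>F2\<^esub> u) p"
      using agree_hyperbolic[of "inv\<^bsub>F2\<^esub> u" v p] left h vp by simp
    show "agree (inv\<^bsub>F2\<^esub> u) p \<le> h"
      using agree_le_length[of "inv\<^bsub>F2\<^esub> u" p] h by simp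
  qed
  have lup: "length (u \<otimes>\<^bsub>F2\<^esub> p) + h = length u"
    using length_mult[OF u p] up h by simp
  have "agree (inv\<^bsub>F2\<^esub> q) (inv\<^bsub>F2\<^esub> v) = h"
    using length_mult[of q "inv\<^bsub>F2\<^esub> v"] p v q lq h
    by (simp add: q_def F2.m_assoc)
  then have "h \<le> agree (inv\<^bsub>F2\<^esub> q) u"
    using agree_hyperbolic[of "inv\<^bsub>F2\<^esub> q" "inv\<^bsub>F2\<^esub> v" u] right h by simp
  moreover have "h \<le> agree u (u \<otimes>\<^bsub>F2\<^esub> p)"
    using length_inv_mult[of u "u \<otimes>\<^bsub>F2\<^esub> p"] lup u p h le by (simp add: F2.inv_mult_cancel)
  ultimately have "h \<le> agree (inv\<^bsub>F2\<^esub> q) (u \<otimes>\<^bsub>F2\<^esub> p)"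
    using agree_hyperbolic[of "inv\<^bsub>F2\<^esub> q" u "u \<otimes>\<^bsub>F2\<^esub> p"] by simp
  then have "length (q \<otimes>\<^bsub>F2\<^esub> (u \<otimes>\<^bsub>F2\<^esub> p)) + 2 * h \<le> length u"
    using length_mult[of q "u \<otimes>\<^bsub>F2\<^esub> p"] q u p lq lup by simp
  moreover have "length (q \<otimes>\<^bsub>F2\<^esub> p) \<le> 2 * h"
    using length_mult[OF q p] lq h by simp
  moreover have "inv\<^bsub>F2\<^esub> p \<otimes>\<^bsub>F2\<^esub> (v \<otimes>\<^bsub>F2\<^esub> u) \<otimes>\<^bsub>F2\<^esub> p = q \<otimes>\<^bsub>F2\<^esub> (u \<otimes>\<^bsub>F2\<^esub> p)"
    using p u v by (simp add: q_def F2.m_assoc)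
  ultimately show "length (inv\<^bsub>F2\<^esub> p \<otimes>\<^bsub>F2\<^esub> v \<otimes>\<^bsub>F2\<^esub> p) +
      length (inv\<^bsub>F2\<^esub> p \<otimes>\<^bsub>F2\<^esub> (v \<otimes>\<^bsub>F2\<^esub> u) \<otimes>\<^bsub>F2\<^esub> p) \<le> length u"
    by (simp add: q_def)
qed

lemma nielsen_closed_generate: "nielsen_closed (\<lambda>u v. generate F2 {u, v} = carrier F2)"
proof -
  have eqI: "generate F2 {u', v'} = carrier F2"
    if "generate F2 {u, v} = carrier F2" "u' \<in> carrier F2" "v' \<in> carrier F2"
      "u \<in> generate F2 {u', v'}" "v \<in> generate F2 {u', v'}" for u v u' v'
  proof
    show "generate F2 {u', v'} \<subseteq> carrier F2"
      using that by (intro F2.generate_incl) auto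
    have "generate F2 {u, v} \<subseteq> generate F2 {u', v'}"
      using that by (intro F2.generate_subgroup_incl F2.generate_is_subgroup) auto
    then show "carrier F2 \<subseteq> generate F2 {u', v'}" using that(1) by simp
  qed
  have gen_mult: "w \<otimes>\<^bsub>F2\<^esub> w' \<in> generate F2 S" if "w \<in> generate F2 S" "w' \<in> generate F2 S" for w w' S
    using that by (rule generate.eng)
  have gen_inv: "inv\<^bsub>F2\<^esub> w \<in> generate F2 {u, v}"
    if "w \<in> generate F2 {u, v}" "u \<in> carrier F2" "v \<in> carrier F2" for w u v
    using F2.generate_m_inv_closed[of "{u, v}" w] that by simp
  have gen_incl: "w \<in> generate F2 {u, v}" if "w = u \<or> w = v" for u v w
    using that by (auto intro: generate.incl)
  show ?thesis
    unfolding nielsen_closed_def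
  proof (intro ballI impI conjI)
    fix u v assume uv: "u \<in> carrier F2" "v \<in> carrier F2" and gen: "generate F2 {u, v} = carrier F2"
    show "generate F2 {v, u} = carrier F2"
      using gen by (simp add: insert_commute)
    show "generate F2 {u, inv\<^bsub>F2\<^esub> v} = carrier F2"
      using gen_inv[of "inv\<^bsub>F2\<^esub> v" u "inv\<^bsub>F2\<^esub> v"] uv
      by (intro eqI[OF gen]) (simp_all add: gen_incl)
    have "inv\<^bsub>F2\<^esub> u \<otimes>\<^bsub>F2\<^esub> (u \<otimes>\<^bsub>F2\<^esub> v) \<in> generate F2 {u, u \<otimes>\<^bsub>F2\<^esub> v}"
      using uv gen_mult[OF gen_inv[OF gen_incl] gen_incl] by simp
    then have "v \<in> generate F2 {u, u \<otimes>\<^bsub>F2\<^esub> v}"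
      using uv by (simp add: F2.inv_mult_cancel)
    then show "generate F2 {u, u \<otimes>\<^bsub>F2\<^esub> v} = carrier F2"
      using uv by (intro eqI[OF gen]) (simp_all add: gen_incl)
    fix g assume g: "g \<in> carrier F2"
    interpret c: group_hom F2 F2 "\<lambda>w. g \<otimes>\<^bsub>F2\<^esub> w \<otimes>\<^bsub>F2\<^esub> inv\<^bsub>F2\<^esub> g"
      by unfold_locales (rule F2.conjugation_hom[OF g])
    show "generate F2 {g \<otimes>\<^bsub>F2\<^esub> u \<otimes>\<^bsub>F2\<^esub> inv\<^bsub>F2\<^esub> g, g \<otimes>\<^bsub>F2\<^esub> v \<otimes>\<^bsub>F2\<^esub> inv\<^bsub>F2\<^esub> g} = carrier F2"
      using c.generate_img[of "{u, v}"] F2.conjugation_image[OF g] uv gen by simp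
  qed
qed

lemma not_generated_by_one:
  assumes "v \<in> carrier F2"
  shows "generate F2 {[], v} \<noteq> carrier F2"
proof
  assume gen: "generate F2 {[], v} = carrier F2"
  have "generate F2 {[], v} \<subseteq> generate F2 {v}"
    using assms generate.one[of F2 "{v}"]
    by (intro F2.generate_subgroup_incl F2.generate_is_subgroup) (auto intro: generate.incl simp: one_free_group)
  then have powers: "\<exists>i::int. w = v [^]\<^bsub>F2\<^esub> i" if "w \<in> carrier F2" for w
    using that gen F2.generate_pow[OF assms] by auto
  obtain i j :: int where "[(True, True)] = v [^]\<^bsub>F2\<^esub> i" "[(False, True)] = v [^]\<^bsub>F2\<^esub> j"
    using powers[OF letter_in_carrier] by (metis UNIV_I)
  then have "[(True, True)] \<otimes>\<^bsub>F2\<^esub> [(False, True)] = [(False, True)] \<otimes>\<^bsub>F2\<^esub> [(True, True)]"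
    using assms by (simp add: F2.int_pow_mult[symmetric] add.commute)
  then show False by (simp add: mult_free_group inv_letter_def)
qed

text \<open>
  Nielsen's theorem for rank two. A pair that no move shortens satisfies the hypothesis of
  \<open>length_hom_ge\<close>; as the pair generates, each basis letter is the value of a word, and by the length
  estimate this word is a single letter.
\<close>
lemma nielsen_reduction:
  assumes P: "nielsen_closed P" and base: "P [(True, True)] [(False, True)]"
    and "u \<in> carrier F2" "v \<in> carrier F2" "generate F2 {u, v} = carrier F2"
  shows "P u v"
  using assms(3-5)
proof (induction "length u + length v" arbitrary: u v rule: less_induct)
  case less
  obtain \<phi> where hom: "\<phi> \<in> hom F2 F2"
    and \<phi>: "\<phi> [(True, True)] = u" "\<phi> [(False, True)] = v"
    using free_group_universal[OF group_free_group, of "\<lambda>b. if b then u else v" UNIV UNIV] less.prems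
    by auto
  interpret \<phi>: group_hom F2 F2 \<phi>
    by unfold_locales (rule hom)
  have letter [simp]: "[l] \<in> carrier F2" for l
    by (simp add: carrier_F2 reduced_Cons)
  have \<phi>_inv: "\<phi> [inv_letter l] = inv\<^bsub>F2\<^esub> \<phi> [l]" for l
  proof -
    have "inv\<^bsub>F2\<^esub> [l] = [inv_letter l]" by (simp add: inv_F2 word_inv_def)
    then show ?thesis using \<phi>.hom_inv[OF letter[of l]] by simp
  qed
  have len: "length (\<phi> [l]) = (if fst l then length u else length v)" for l
    using \<phi> \<phi>_inv[of "(True, True)"] \<phi>_inv[of "(False, True)"] less.prems
    by (cases l; cases "fst l"; cases "snd l") (auto simp: inv_letter_def)
  note gen = nielsen_closed_generate
  have gen_letters: "generate F2 {\<phi> [l], \<phi> [m]} = carrier F2" if "fst l \<noteq> fst m" for l m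
    using nielsen_letters[OF gen hom that] less.prems \<phi> by simp
  show "P u v"
  proof (cases "\<forall>l m. fst l \<noteq> fst m \<longrightarrow> 2 * agree (inv\<^bsub>F2\<^esub> \<phi> [l]) (\<phi> [m]) \<le> length (\<phi> [l])")
    case False
    then obtain l m where lm: "fst l \<noteq> fst m" "length (\<phi> [l]) < 2 * agree (inv\<^bsub>F2\<^esub> \<phi> [l]) (\<phi> [m])"
      by (auto simp: not_le)
    have "length (\<phi> [l] \<otimes>\<^bsub>F2\<^esub> \<phi> [m]) < length (\<phi> [m])"
      using length_mult[of "\<phi> [l]" "\<phi> [m]"] lm(2) by simp
    then have "P (\<phi> [l]) (\<phi> [l] \<otimes>\<^bsub>F2\<^esub> \<phi> [m])"
      using lm(1) gen_letters[OF lm(1)] nielsen_mult[OF gen, of "\<phi> [l]" "\<phi> [m]"]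
      by (intro less.hyps) (auto simp: len split: if_splits)
    then show ?thesis
      using nielsen_mult[OF P] nielsen_letters[OF P hom lm(1)] \<phi> by simp
  next
    case True
    then have half: "2 * agree (inv\<^bsub>F2\<^esub> \<phi> [l]) (\<phi> [m]) \<le> length (\<phi> [l])"
      if "fst l \<noteq> fst m" for l m
      using that by blast
    have half': "2 * agree (inv\<^bsub>F2\<^esub> \<phi> [l]) (\<phi> [m]) \<le> length (\<phi> [m])"
      if "fst l \<noteq> fst m" for l m
      using half[of "inv_letter m" "inv_letter l"] that by (simp add: \<phi>_inv agree_commute)
    have nontrivial: "\<phi> [l] \<noteq> []" for l
    proof
      assume "\<phi> [l] = []"
      moreover have "generate F2 {\<phi> [l], \<phi> [(\<not> fst l, True)]} = carrier F2"
        by (rule gen_letters) simp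
      ultimately show False
        using not_generated_by_one[OF \<phi>.hom_closed[OF letter]] by metis
    qed
    show ?thesis
    proof (cases "\<exists>l m. fst l \<noteq> fst m \<and> 2 * agree (inv\<^bsub>F2\<^esub> \<phi> [l]) (\<phi> [m]) = length (\<phi> [m]) \<and>
        2 * agree (inv\<^bsub>F2\<^esub> \<phi> [m]) (\<phi> [l]) = length (\<phi> [m])")
      case True
      then obtain l m where lm: "fst l \<noteq> fst m"
        "2 * agree (inv\<^bsub>F2\<^esub> \<phi> [l]) (\<phi> [m]) = length (\<phi> [m])"
        "2 * agree (inv\<^bsub>F2\<^esub> \<phi> [m]) (\<phi> [l]) = length (\<phi> [m])" by blast
      define p where "p = take (length (\<phi> [m]) div 2) (\<phi> [m])"
      have "length (\<phi> [m]) \<le> length (\<phi> [l])" using half[OF lm(1)] lm(2) by simp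
      note p = half_cancelling_conj[OF _ _ this lm(2,3), folded p_def, simplified]
      have lt: "length (\<phi> [l]) < length u + length v"
        using lm(1) nontrivial[of m] nontrivial[of l] len[of l] len[of m] by (auto split: if_splits)
      have equiv: "Q (inv\<^bsub>F2\<^esub> p \<otimes>\<^bsub>F2\<^esub> \<phi> [m] \<otimes>\<^bsub>F2\<^esub> p)
          (inv\<^bsub>F2\<^esub> p \<otimes>\<^bsub>F2\<^esub> (\<phi> [m] \<otimes>\<^bsub>F2\<^esub> \<phi> [l]) \<otimes>\<^bsub>F2\<^esub> p) \<longleftrightarrow> Q u v" if "nielsen_closed Q" for Q
        using nielsen_conj[OF that _ _ p(1), of "\<phi> [m]" "\<phi> [m] \<otimes>\<^bsub>F2\<^esub> \<phi> [l]"]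
          nielsen_mult[OF that, of "\<phi> [m]" "\<phi> [l]"] nielsen_letters[OF that hom, of m l] lm(1) \<phi>
        by simp
      have "P (inv\<^bsub>F2\<^esub> p \<otimes>\<^bsub>F2\<^esub> \<phi> [m] \<otimes>\<^bsub>F2\<^esub> p)
          (inv\<^bsub>F2\<^esub> p \<otimes>\<^bsub>F2\<^esub> (\<phi> [m] \<otimes>\<^bsub>F2\<^esub> \<phi> [l]) \<otimes>\<^bsub>F2\<^esub> p)"
        using p lt equiv[OF gen] less.prems by (intro less.hyps) auto
      then show ?thesis using equiv[OF P] by simp
    next
      case no_conj: False
      have cancel: "agree (inv\<^bsub>F2\<^esub> \<phi> [l]) (\<phi> [m]) + agree (inv\<^bsub>F2\<^esub> \<phi> [m]) (\<phi> [n]) < length (\<phi> [m])"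
        if lm: "m \<noteq> inv_letter l" and mn: "n \<noteq> inv_letter m" for l m n
      proof -
        have self: "2 * agree (inv\<^bsub>F2\<^esub> \<phi> [m]) (\<phi> [m]) < length (\<phi> [m])"
          using agree_inv_self[of "\<phi> [m]"] nontrivial by simp
        have same: "l = m" if "fst l = fst m" "m \<noteq> inv_letter l" for l m :: "bool \<times> bool"
          using that by (auto simp: inv_letter_def prod_eq_iff)
        consider "l = m" | "n = m" | "fst l \<noteq> fst m" "fst n \<noteq> fst m"
          using lm mn by (cases l; cases m; cases n) (auto simp: inv_letter_def)
        then show ?thesis
        proof cases
          case 1
          then show ?thesis
            using self half[of m n] same[OF _ mn] by (cases "fst m = fst n") auto
        next
          case 2
          then show ?thesis
            using self half'[of l m] same[OF _ lm] by (cases "fst l = fst m") auto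
        next
          case 3
          have le: "2 * agree (inv\<^bsub>F2\<^esub> \<phi> [l]) (\<phi> [m]) \<le> length (\<phi> [m])"
            "2 * agree (inv\<^bsub>F2\<^esub> \<phi> [m]) (\<phi> [n]) \<le> length (\<phi> [m])"
            using half'[of l m] half[of m n] 3 by auto
          show ?thesis
          proof (rule ccontr)
            assume "\<not> ?thesis"
            then have eq: "2 * agree (inv\<^bsub>F2\<^esub> \<phi> [l]) (\<phi> [m]) = length (\<phi> [m])"
              "2 * agree (inv\<^bsub>F2\<^esub> \<phi> [m]) (\<phi> [n]) = length (\<phi> [m])"
              using le by linarith+
            have "n = l \<or> n = inv_letter l"
              using 3 by (auto simp: inv_letter_def prod_eq_iff)
            then show False
            proof
              assume "n = l"
              then show False using no_conj 3 eq by blast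
            next
              assume "n = inv_letter l"
              then have "2 * agree (inv\<^bsub>F2\<^esub> \<phi> [m]) (inv\<^bsub>F2\<^esub> \<phi> [l]) = length (\<phi> [m])"
                using eq(2) by (simp add: \<phi>_inv)
              then show False
                using agree_hyperbolic[of "inv\<^bsub>F2\<^esub> \<phi> [m]" "inv\<^bsub>F2\<^esub> \<phi> [l]" "\<phi> [m]"] eq(1) self
                by simp
            qed
          qed
        qed
      qed
      have "\<exists>l. \<phi> [l] = [m]" for m
      proof -
        have "generate F2 {u, v} = \<phi> ` generate F2 {[(True, True)], [(False, True)]}"
          using \<phi>.generate_img[of "{[(True, True)], [(False, True)]}"] \<phi> by simp
        then have "[m] \<in> \<phi> ` generate F2 {[(True, True)], [(False, True)]}"
          using less.prems(3) letter[of m] by simp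
        moreover have "generate F2 {[(True, True)], [(False, True)]} \<subseteq> carrier F2"
          by (rule F2.generate_incl) simp
        ultimately obtain w where w: "w \<in> carrier F2" "\<phi> w = [m]"
          by (metis imageE subsetD)
        moreover have "w \<noteq> []" using w(2) \<phi>.hom_one by (auto simp: one_free_group)
        moreover have "length w \<le> length (\<phi> w)"
          using length_hom_ge[OF hom cancel w(1)] .
        ultimately obtain l where "w = [l]" by (cases w) auto
        then show ?thesis using w by blast
      qed
      then obtain l m where lm: "\<phi> [l] = [(True, True)]" "\<phi> [m] = [(False, True)]" by meson
      have "fst l \<noteq> fst m"
      proof
        assume "fst l = fst m"
        then have "m = l \<or> m = inv_letter l" by (auto simp: inv_letter_def prod_eq_iff)
        then show False
          using lm \<phi>_inv[of l] by (auto simp: inv_F2 word_inv_def inv_letter_def)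
      qed
      from nielsen_letters[OF P hom this] show ?thesis using base lm \<phi> by simp
    qed
  qed
qed

section \<open>Homomorphisms that kill the powers of primitive elements\<close>

context group
begin

definition conjugate :: "'a \<Rightarrow> 'a \<Rightarrow> 'a" where
  "conjugate g x = g \<otimes> x \<otimes> inv g"

lemma conjugate_closed [simp]: "g \<in> carrier G \<Longrightarrow> x \<in> carrier G \<Longrightarrow> conjugate g x \<in> carrier G"
  by (simp add: conjugate_def)

lemma conjugate_conjugate:
  "g \<in> carrier G \<Longrightarrow> f \<in> carrier G \<Longrightarrow> x \<in> carrier G \<Longrightarrow>
     conjugate g (conjugate f x) = conjugate (g \<otimes> f) x"
  by (simp add: conjugate_def m_assoc inv_mult_group)

lemma conjugate_mult:
  "g \<in> carrier G \<Longrightarrow> x \<in> carrier G \<Longrightarrow> y \<in> carrier G \<Longrightarrow>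
     conjugate g x \<otimes> conjugate g y = conjugate g (x \<otimes> y)"
  by (simp add: conjugate_def m_assoc inv_mult_cancel)

lemma conjugate_inv:
  "g \<in> carrier G \<Longrightarrow> x \<in> carrier G \<Longrightarrow> inv (conjugate g x) = conjugate g (inv x)"
  by (simp add: conjugate_def m_assoc inv_mult_group)

lemma conjugate_inv_conjugate:
  "g \<in> carrier G \<Longrightarrow> x \<in> carrier G \<Longrightarrow> conjugate (inv g) (conjugate g x) = x"
  by (simp add: conjugate_def m_assoc inv_mult_cancel)

lemma conjugate_pow:
  "g \<in> carrier G \<Longrightarrow> x \<in> carrier G \<Longrightarrow> conjugate g x [^] (n::nat) = conjugate g (x [^] n)"
  by (induction n) (simp_all add: conjugate_mult, simp add: conjugate_def)

lemma conjugate_eqI: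
  "g \<otimes> x = y \<otimes> g \<Longrightarrow> g \<in> carrier G \<Longrightarrow> x \<in> carrier G \<Longrightarrow> y \<in> carrier G \<Longrightarrow> conjugate g x = y"
  by (simp add: conjugate_def m_assoc)

text \<open>
  The elements \<open>s\<close>, \<open>t\<close>, \<open>r\<close> play the roles of \<open>\<sigma>\<^sub>1\<close>, \<open>\<sigma>\<^sub>3\<close> and \<open>\<sigma>\<^sub>2 \<sigma>\<^sub>1 \<sigma>\<^sub>3\<close>: conjugation by them realises
  \<open>b \<mapsto> ba\<^sup>-\<^sup>1\<close>, \<open>b \<mapsto> a\<^sup>-\<^sup>1b\<close> (both fixing \<open>a\<close>) and \<open>(a, b) \<mapsto> (b, a\<^sup>-\<^sup>1)\<close>. Moves of determinant \<open>-1\<close> need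
  not be realised by conjugation; hence the two alternatives in the invariant, which says that one of the
  pairs \<open>(u, v)\<close>, \<open>(u, v\<^sup>-\<^sup>1)\<close> is mapped to a simultaneous conjugate of \<open>(a, b)\<close>.
\<close>
lemma primitive_power_eq_one:
  fixes k :: nat
  assumes hom: "h \<in> hom F2 G"
    and a: "h [(True, True)] = a" and b: "h [(False, True)] = b"
    and closed [simp]: "s \<in> carrier G" "t \<in> carrier G" "r \<in> carrier G"
    and s: "conjugate s a = a" "conjugate s (b \<otimes> a) = b"
    and t: "conjugate t a = a" "conjugate t (a \<otimes> b) = b"
    and r: "conjugate r a = b" "conjugate r b = inv a"
    and pow: "a [^] k = \<one>"
    and x: "x \<in> primitive_elements"
  shows "h (x [^]\<^bsub>F2\<^esub> k) = \<one>"
proof -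
  interpret h: group_hom F2 G h
    by unfold_locales (rule hom)
  have ab [simp]: "a \<in> carrier G" "b \<in> carrier G"
    using a b h.hom_closed[OF letter_in_carrier] by auto
  define P where "P = (\<lambda>u v. \<exists>g\<in>carrier G. h u = conjugate g a \<and>
    (h v = conjugate g b \<or> h v = conjugate g (inv b)))"
  have r_inv: "conjugate r (inv b) = a" "conjugate r (inv a) = inv b"
    using r conjugate_inv[of r b] conjugate_inv[of r a] by auto
  have "conjugate s b = b \<otimes> inv a"
    using s conjugate_mult[of s b a] by (simp add: inv_solve_right)
  then have s_inv: "conjugate s (inv b) = a \<otimes> inv b"
    using conjugate_inv[of s b] by (simp add: inv_mult_group)
  have t_inv: "conjugate (inv t) a = a" "conjugate (inv t) b = a \<otimes> b"
    using t conjugate_inv_conjugate[of t a] conjugate_inv_conjugate[of t "a \<otimes> b"] by simp_all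
  have "nielsen_closed P"
    unfolding nielsen_closed_def
  proof (intro ballI impI conjI)
    fix u v assume uv [simp]: "u \<in> carrier F2" "v \<in> carrier F2" and "P u v"
    then obtain g where g [simp]: "g \<in> carrier G" and u: "h u = conjugate g a"
      and v: "h v = conjugate g b \<or> h v = conjugate g (inv b)"
      unfolding P_def by blast
    show "P v u"
      using v
    proof
      assume "h v = conjugate g b"
      then have "h v = conjugate (g \<otimes> r) a" "h u = conjugate (g \<otimes> r) (inv b)"
        using u by (simp_all flip: conjugate_conjugate add: r r_inv)
      then show ?thesis unfolding P_def by (meson g closed m_closed)
    next
      assume "h v = conjugate g (inv b)"
      then have "h v = conjugate (g \<otimes> r \<otimes> r \<otimes> r) a" "h u = conjugate (g \<otimes> r \<otimes> r \<otimes> r) b"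
        using u by (simp_all flip: conjugate_conjugate add: r r_inv)
      then show ?thesis unfolding P_def by (meson g closed m_closed)
    qed
    show "P u (inv\<^bsub>F2\<^esub> v)"
      using u v unfolding P_def by (intro bexI[of _ g]) (auto simp: conjugate_inv)
    show "P u (u \<otimes>\<^bsub>F2\<^esub> v)"
      using v
    proof
      assume "h v = conjugate g b"
      then have "h u = conjugate (g \<otimes> inv t) a" "h (u \<otimes>\<^bsub>F2\<^esub> v) = conjugate (g \<otimes> inv t) b"
        using u by (simp_all flip: conjugate_conjugate add: t_inv conjugate_mult)
      then show ?thesis unfolding P_def by (meson g closed inv_closed m_closed)
    next
      assume "h v = conjugate g (inv b)"
      then have "h u = conjugate (g \<otimes> s) a" "h (u \<otimes>\<^bsub>F2\<^esub> v) = conjugate (g \<otimes> s) (inv b)"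
        using u by (simp_all flip: conjugate_conjugate add: s s_inv conjugate_mult)
      then show ?thesis unfolding P_def by (meson g closed m_closed)
    qed
    fix f assume f: "f \<in> carrier F2"
    have *: "h (f \<otimes>\<^bsub>F2\<^esub> w \<otimes>\<^bsub>F2\<^esub> inv\<^bsub>F2\<^esub> f) = conjugate (h f) (h w)" if "w \<in> carrier F2" for w
      using f that by (simp add: conjugate_def)
    show "P (f \<otimes>\<^bsub>F2\<^esub> u \<otimes>\<^bsub>F2\<^esub> inv\<^bsub>F2\<^esub> f) (f \<otimes>\<^bsub>F2\<^esub> v \<otimes>\<^bsub>F2\<^esub> inv\<^bsub>F2\<^esub> f)"
      unfolding P_def *[OF uv(1)] *[OF uv(2)] using u v f
      by (intro bexI[of _ "h f \<otimes> g"]) (auto simp: conjugate_conjugate)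
  qed
  moreover have "P [(True, True)] [(False, True)]"
    unfolding P_def a b by (intro bexI[of _ \<one>]) (auto simp: conjugate_def)
  moreover obtain y where y: "x \<in> carrier F2" "y \<in> carrier F2" "generate F2 {x, y} = carrier F2"
  proof -
    obtain S where "S \<subseteq> carrier F2" "card S = 2" "x \<in> S" "generate F2 S = carrier F2"
      using x unfolding primitive_elements_def by blast
    then show ?thesis using that by (auto simp: card_2_iff insert_commute)
  qed
  ultimately obtain g where "g \<in> carrier G" "h x = conjugate g a"
    using nielsen_reduction unfolding P_def by blast
  then have "h x [^] k = \<one>"
    by (simp add: conjugate_pow pow) (simp add: conjugate_def)
  then show ?thesis using y(1) by (simp add: h.hom_nat_pow)
qed

end

section \<open>Finiteness for exponents up to three\<close>

context group
begin

text \<open>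
  On a finite set, left multiplication by an element of \<open>S\<close> is onto as soon as it maps the set into
  itself; so inverses of elements of \<open>S\<close> preserve the set as well.
\<close>
lemma generate_subset_of_left_invariant:
  assumes S: "S \<subseteq> carrier G" and E: "finite E" "E \<subseteq> carrier G" "\<one> \<in> E"
    and left: "\<And>x e. x \<in> S \<Longrightarrow> e \<in> E \<Longrightarrow> x \<otimes> e \<in> E"
  shows "generate G S \<subseteq> E"
proof -
  have inv_left: "inv x \<otimes> e \<in> E" if x: "x \<in> S" and e: "e \<in> E" for x e
  proof -
    have "inj_on ((\<otimes>) x) E"
      using S E(2) x by (auto intro!: inj_onI simp: subset_iff)
    then have "(\<otimes>) x ` E = E"
      using left[OF x] E(1) by (intro endo_inj_surj) auto
    then obtain e' where "e' \<in> E" "e = x \<otimes> e'"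
      using e by blast
    then show ?thesis
      using S E(2) x by (auto simp: inv_mult_cancel subset_iff)
  qed
  have "\<forall>e\<in>E. w \<otimes> e \<in> E" if "w \<in> generate G S" for w
    using that
  proof induction
    case (eng w1 w2)
    then show ?case
      using generate_in_carrier[OF S] E(2) by (auto simp: m_assoc subset_iff)
  qed (use S E(2) left inv_left in \<open>auto simp: subset_iff\<close>)
  then show ?thesis
    using E(3) generate_in_carrier[OF S] by fastforce
qed

lemma finite_heisenberg:
  fixes k :: nat
  assumes closed [simp]: "a \<in> carrier G" "b \<in> carrier G" "c \<in> carrier G"
    and "k > 0" and pow: "a [^] k = \<one>" "b [^] k = \<one>" "c [^] k = \<one>"
    and ba: "b \<otimes> a = a \<otimes> b \<otimes> c" and central: "c \<otimes> a = a \<otimes> c" "c \<otimes> b = b \<otimes> c"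
    and gen: "generate G {a, b} = carrier G"
  shows "finite (carrier G)"
proof -
  define e where "e = (\<lambda>(i::nat, j::nat, l::nat). a [^] i \<otimes> (b [^] j \<otimes> c [^] l))"
  have pow_mod: "z [^] (n mod k) = z [^] n" if "z \<in> carrier G" "z [^] k = \<one>" for z and n :: nat
  proof -
    have "z [^] n = z [^] (k * (n div k) + n mod k)" by simp
    also have "\<dots> = z [^] (n mod k)"
      using that by (simp only: nat_pow_mult[symmetric] nat_pow_pow[symmetric] nat_pow_one l_one nat_pow_closed)
    finally show ?thesis by simp
  qed
  have "range e \<subseteq> e ` ({..<k} \<times> {..<k} \<times> {..<k})"
  proof clarify
    fix i j l
    have "e (i, j, l) = e (i mod k, j mod k, l mod k)"
      using pow by (simp add: e_def pow_mod)
    then show "e (i, j, l) \<in> e ` ({..<k} \<times> {..<k} \<times> {..<k})"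
      using \<open>k > 0\<close> by force
  qed
  then have "finite (range e)" by (rule finite_subset) simp
  have b_shift: "b \<otimes> a [^] i = a [^] i \<otimes> (b \<otimes> c [^] i)" for i :: nat
  proof (induction i)
    case (Suc i)
    have "c [^] i \<otimes> a = a \<otimes> c [^] i"
      by (rule group_commutes_pow) (simp_all add: central)
    moreover have "b \<otimes> a [^] Suc i = a [^] i \<otimes> (b \<otimes> (c [^] i \<otimes> a))"
      using Suc by (simp add: m_assoc[symmetric])
    ultimately have "b \<otimes> a [^] Suc i = a [^] i \<otimes> ((b \<otimes> a) \<otimes> c [^] i)"
      by (simp add: m_assoc)
    moreover have "c \<otimes> c [^] i = c [^] i \<otimes> c"
      using group_commutes_pow[of c c i] by simp
    ultimately show ?case
      by (simp add: ba m_assoc)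
  qed simp
  have "x \<otimes> e p \<in> range e" if "x \<in> {a, b}" for x p
  proof -
    obtain i j l where p: "p = (i, j, l)" by (cases p)
    have "a \<otimes> e p = e (Suc i, j, l)"
      by (simp add: p e_def m_assoc nat_pow_Suc2 del: nat_pow_Suc Group.nat_pow_Suc)
    moreover have "b \<otimes> e p = e (i, Suc j, i + l)"
    proof -
      have comm: "c [^] i \<otimes> b [^] j = b [^] j \<otimes> c [^] i"
        by (intro group_commutes_pow group_commutes_pow[symmetric]) (simp_all add: central)
      have "b \<otimes> e p = (b \<otimes> a [^] i) \<otimes> (b [^] j \<otimes> c [^] l)"
        by (simp add: p e_def m_assoc)
      also have "\<dots> = a [^] i \<otimes> (b \<otimes> (c [^] i \<otimes> b [^] j) \<otimes> c [^] l)"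
        by (simp add: b_shift m_assoc)
      also have "\<dots> = e (i, Suc j, i + l)"
        by (simp add: comm e_def nat_pow_Suc2 nat_pow_mult[symmetric] m_assoc
            del: nat_pow_Suc Group.nat_pow_Suc)
      finally show ?thesis .
    qed
    ultimately show ?thesis using that by auto
  qed
  moreover have "\<one> \<in> range e"
    by (rule range_eqI[of _ _ "(0, 0, 0)"]) (simp add: e_def)
  moreover have "range e \<subseteq> carrier G"
    by (auto simp: e_def)
  ultimately have "generate G {a, b} \<subseteq> range e"
    using \<open>finite (range e)\<close> by (intro generate_subset_of_left_invariant) auto
  then show ?thesis
    using gen \<open>finite (range e)\<close> finite_subset by simp
qed

text \<open>
  Put \<open>d = b a b\<^sup>-\<^sup>1\<close> and \<open>f = b\<^sup>-\<^sup>1 a b = b d b\<^sup>-\<^sup>1\<close>. The cubes of \<open>ab\<close> and \<open>ab\<^sup>-\<^sup>1\<close> are \<open>a d f\<close> and \<open>a f d\<close>, so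
  the three conjugates \<open>a\<close>, \<open>d\<close>, \<open>f\<close> of \<open>a\<close> commute and have product \<open>1\<close>. The commutator \<open>c = d a\<^sup>-\<^sup>1\<close> is
  carried by \<open>b\<close> to \<open>f d\<^sup>-\<^sup>1 = a\<^sup>-\<^sup>1 d\<^sup>-\<^sup>2 = d a\<^sup>-\<^sup>1\<close>, hence is central.
\<close>
lemma heisenberg_if_cubes:
  assumes closed [simp]: "a \<in> carrier G" "b \<in> carrier G"
    and a: "a [^] (3::nat) = \<one>" and b: "b [^] (3::nat) = \<one>"
    and ab: "(a \<otimes> b) [^] (3::nat) = \<one>" "(a \<otimes> inv b) [^] (3::nat) = \<one>"
  obtains c where "c \<in> carrier G" "c [^] (3::nat) = \<one>"
    "b \<otimes> a = a \<otimes> b \<otimes> c" "c \<otimes> a = a \<otimes> c" "c \<otimes> b = b \<otimes> c"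
proof -
  have cube: "x [^] (3::nat) = x \<otimes> (x \<otimes> x)" if "x \<in> carrier G" for x
    using that by (simp add: numeral_3_eq_3 m_assoc)
  have square: "x \<otimes> x = inv x" "inv x \<otimes> inv x = x" if "x [^] (3::nat) = \<one>" "x \<in> carrier G" for x
  proof -
    show 1: "x \<otimes> x = inv x"
      using that inv_equality[of "x \<otimes> x" x] by (simp add: cube m_assoc)
    show "inv x \<otimes> inv x = x"
      using that(2) by (metis 1 inv_inv inv_mult_group)
  qed
  have square': "x \<otimes> (x \<otimes> y) = inv x \<otimes> y" "inv x \<otimes> (inv x \<otimes> y) = x \<otimes> y"
    if "x [^] (3::nat) = \<one>" "x \<in> carrier G" "y \<in> carrier G" for x y
    using that square by (simp_all flip: m_assoc)
  define d where "d = b \<otimes> a \<otimes> inv b"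
  define f where "f = inv b \<otimes> a \<otimes> b"
  have df [simp]: "d \<in> carrier G" "f \<in> carrier G" by (simp_all add: d_def f_def)
  have "a \<otimes> (d \<otimes> f) = \<one>"
    using ab(1) by (simp add: cube d_def f_def m_assoc square'[OF b])
  then have 1: "d \<otimes> f = inv a"
    by (metis closed(1) df inv_comm inv_equality m_closed)
  have "a \<otimes> (f \<otimes> d) = \<one>"
    using ab(2) by (simp add: cube d_def f_def m_assoc square'[OF b])
  then have 2: "f \<otimes> d = inv a"
    by (metis closed(1) df inv_comm inv_equality m_closed)
  have f: "f = inv d \<otimes> inv a" "f = inv a \<otimes> inv d"
    using 1 2 by (metis closed(1) df inv_closed inv_solve_left inv_solve_right)+
  then have ad: "a \<otimes> d = d \<otimes> a"
    by (metis closed(1) df(1) inv_inv inv_mult_group inv_closed)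
  have d3: "d [^] (3::nat) = \<one>"
    by (simp add: cube d_def m_assoc inv_mult_cancel) (simp add: a b cube[symmetric] m_assoc[symmetric])
  have ba: "b \<otimes> a = d \<otimes> b" and bd: "b \<otimes> d = f \<otimes> b"
    by (simp_all add: d_def f_def m_assoc square[OF b] square'[OF b])
  define c where "c = d \<otimes> inv a"
  have c [simp]: "c \<in> carrier G" by (simp add: c_def)
  have comm: "d \<otimes> inv a = inv a \<otimes> d"
    by (metis ad closed(1) df(1) m_assoc square(1)[OF a])
  then have "c [^] (3::nat) = d [^] (3::nat) \<otimes> inv a [^] (3::nat)"
    unfolding c_def by (rule pow_mult_distrib) simp_all
  then have c3: "c [^] (3::nat) = \<one>"
    by (simp add: d3 a nat_pow_inv)
  show thesis
  proof (rule that[OF c c3])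
    show "c \<otimes> a = a \<otimes> c"
      by (simp add: c_def comm m_assoc inv_mult_cancel flip: ad)
    have "a \<otimes> b \<otimes> c = a \<otimes> (b \<otimes> d) \<otimes> inv a"
      by (simp add: c_def m_assoc)
    also have "\<dots> = a \<otimes> f \<otimes> (b \<otimes> a) \<otimes> a"
      by (simp add: bd m_assoc flip: square(1)[OF a])
    also have "\<dots> = a \<otimes> f \<otimes> d \<otimes> (b \<otimes> a)"
      by (simp add: ba m_assoc)
    also have "\<dots> = b \<otimes> a"
      using 2 by (simp add: m_assoc)
    finally show "b \<otimes> a = a \<otimes> b \<otimes> c" by simp
    have "b \<otimes> c = (b \<otimes> d) \<otimes> (a \<otimes> a)"
      by (simp add: c_def square[OF a] m_assoc)
    also have "\<dots> = f \<otimes> (b \<otimes> a) \<otimes> a"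
      by (simp add: bd m_assoc)
    also have "\<dots> = f \<otimes> d \<otimes> (b \<otimes> a)"
      by (simp add: ba m_assoc)
    also have "\<dots> = inv a \<otimes> d \<otimes> b"
      using 2 ba by (simp add: m_assoc)
    also have "\<dots> = c \<otimes> b"
      by (simp add: c_def comm)
    finally show "c \<otimes> b = b \<otimes> c" by simp
  qed
qed

end

lemma generating_pairs:
  fixes x y :: "(bool \<times> bool) list"
  defines "x \<equiv> [(True, True)]" and "y \<equiv> [(False, True)]"
  shows "generate F2 {x, y} = carrier F2"
    and "{x, y, x \<otimes>\<^bsub>F2\<^esub> y, x \<otimes>\<^bsub>F2\<^esub> inv\<^bsub>F2\<^esub> y} \<subseteq> primitive_elements"
proof -
  have xy: "x \<in> carrier F2" "y \<in> carrier F2"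
    by (simp_all add: x_def y_def letter_in_carrier)
  have "{[(b, True)] | b :: bool. b \<in> UNIV} = {x, y}"
    by (auto simp: x_def y_def)
  then show gen: "generate F2 {x, y} = carrier F2"
    using generate_free_group[of "UNIV :: bool set"] by simp
  have primitive: "u \<in> primitive_elements"
    if "generate F2 {u, v} = carrier F2" "u \<in> carrier F2" "v \<in> carrier F2" "u \<noteq> v" for u v
    using that unfolding primitive_elements_def by (intro CollectI exI[of _ "{u, v}"]) auto
  have gens: "generate F2 {y, x} = carrier F2" "generate F2 {x \<otimes>\<^bsub>F2\<^esub> y, x} = carrier F2"
    "generate F2 {x \<otimes>\<^bsub>F2\<^esub> inv\<^bsub>F2\<^esub> y, x} = carrier F2"
    using gen xy nielsen_closed_generate nielsen_mult[OF nielsen_closed_generate, of x]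
      nielsen_inv(1)[OF nielsen_closed_generate, of x y]
    by (simp_all add: insert_commute)
  moreover have "x \<noteq> y" "x \<otimes>\<^bsub>F2\<^esub> y \<noteq> x" "x \<otimes>\<^bsub>F2\<^esub> inv\<^bsub>F2\<^esub> y \<noteq> x"
    by (simp_all add: x_def y_def inv_generator mult_free_group inv_letter_def)
  ultimately show "{x, y, x \<otimes>\<^bsub>F2\<^esub> y, x \<otimes>\<^bsub>F2\<^esub> inv\<^bsub>F2\<^esub> y} \<subseteq> primitive_elements"
    using primitive[OF gen] primitive[OF gens(1)] primitive[OF gens(2)] primitive[OF gens(3)] xy
    by auto
qed

lemma finite_quotient:
  assumes "k \<in> {1, 2, 3 :: nat}"
  shows "finite (carrier (F2 Mod primitive_power_subgroup k))"
proof -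
  define N where "N = primitive_power_subgroup k"
  define Q where "Q = F2 Mod N"
  interpret N: normal N F2
    unfolding N_def by (rule normal_primitive_power_subgroup)
  interpret Q: group Q
    unfolding Q_def by (rule N.factorgroup_is_group)
  have "(\<lambda>w. N #>\<^bsub>F2\<^esub> w) \<in> hom F2 Q"
    unfolding Q_def by (rule N.r_coset_hom_Mod)
  then interpret pr: group_hom F2 Q "\<lambda>w. N #>\<^bsub>F2\<^esub> w"
    by unfold_locales
  let ?x = "[(True, True)] :: (bool \<times> bool) list" and ?y = "[(False, True)] :: (bool \<times> bool) list"
  define a where "a = N #>\<^bsub>F2\<^esub> ?x"
  define b where "b = N #>\<^bsub>F2\<^esub> ?y"
  have xy: "?x \<in> carrier F2" "?y \<in> carrier F2"
    by (simp_all add: letter_in_carrier)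
  have ab [simp]: "a \<in> carrier Q" "b \<in> carrier Q"
    using pr.hom_closed xy unfolding a_def b_def by blast+
  have pow: "(N #>\<^bsub>F2\<^esub> w) [^]\<^bsub>Q\<^esub> k = \<one>\<^bsub>Q\<^esub>" if "w \<in> primitive_elements" for w
  proof -
    have w: "w \<in> carrier F2" using that primitive_elements_carrier by blast
    have "w [^]\<^bsub>F2\<^esub> k \<in> N"
      using that unfolding N_def primitive_power_subgroup_def by (auto intro: generate.incl)
    then have "N #>\<^bsub>F2\<^esub> (w [^]\<^bsub>F2\<^esub> k) = \<one>\<^bsub>Q\<^esub>"
      using F2.coset_join2[OF _ N.subgroup_axioms] w by (simp add: Q_def FactGroup_def)
    then show ?thesis using pr.hom_nat_pow[OF w] by simp
  qed
  have rel: "a [^]\<^bsub>Q\<^esub> k = \<one>\<^bsub>Q\<^esub>" "b [^]\<^bsub>Q\<^esub> k = \<one>\<^bsub>Q\<^esub>"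
    "(a \<otimes>\<^bsub>Q\<^esub> b) [^]\<^bsub>Q\<^esub> k = \<one>\<^bsub>Q\<^esub>" "(a \<otimes>\<^bsub>Q\<^esub> inv\<^bsub>Q\<^esub> b) [^]\<^bsub>Q\<^esub> k = \<one>\<^bsub>Q\<^esub>"
    using generating_pairs(2) xy by (auto simp: a_def b_def pow simp flip: pr.hom_mult pr.hom_inv)
  have "(\<lambda>w. N #>\<^bsub>F2\<^esub> w) ` carrier F2 = carrier Q"
    by (auto simp: Q_def FactGroup_def RCOSETS_def)
  then have gen: "generate Q {a, b} = carrier Q"
    using pr.generate_img[of "{?x, ?y}"] generating_pairs(1) xy by (simp add: a_def b_def)
  obtain c where "c \<in> carrier Q" "c [^]\<^bsub>Q\<^esub> k = \<one>\<^bsub>Q\<^esub>" "b \<otimes>\<^bsub>Q\<^esub> a = a \<otimes>\<^bsub>Q\<^esub> b \<otimes>\<^bsub>Q\<^esub> c"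
    "c \<otimes>\<^bsub>Q\<^esub> a = a \<otimes>\<^bsub>Q\<^esub> c" "c \<otimes>\<^bsub>Q\<^esub> b = b \<otimes>\<^bsub>Q\<^esub> c"
  proof -
    consider "k = 1" | "k = 2" | "k = 3" using assms by auto
    then show thesis
    proof cases
      case 1
      then show ?thesis using that[of "\<one>\<^bsub>Q\<^esub>"] rel by simp
    next
      case 2
      have "b \<otimes>\<^bsub>Q\<^esub> a = a \<otimes>\<^bsub>Q\<^esub> b"
      proof -
        have self_inv: "inv\<^bsub>Q\<^esub> w = w" if "w \<in> carrier Q" "w [^]\<^bsub>Q\<^esub> k = \<one>\<^bsub>Q\<^esub>" for w
          using that 2 by (intro Q.inv_equality) (simp_all add: numeral_2_eq_2)
        have "inv\<^bsub>Q\<^esub> b \<otimes>\<^bsub>Q\<^esub> inv\<^bsub>Q\<^esub> a = inv\<^bsub>Q\<^esub> (a \<otimes>\<^bsub>Q\<^esub> b)"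
          by (simp add: Q.inv_mult_group)
        then show ?thesis using rel by (simp add: self_inv)
      qed
      then show ?thesis using that[of "\<one>\<^bsub>Q\<^esub>"] by simp
    next
      case 3
      then show ?thesis using Q.heisenberg_if_cubes[of a b thesis] rel that by simp
    qed
  qed
  then have "finite (carrier Q)"
    using Q.finite_heisenberg[OF _ _ _ _ rel(1,2), of c] gen assms by auto
  then show ?thesis by (simp add: Q_def N_def)
qed

section \<open>The reduced Burau representation\<close>

definition bijections :: "('a \<Rightarrow> 'a) monoid" where
  "bijections = \<lparr>carrier = {f. bij f}, mult = (\<circ>), one = id\<rparr>"

lemma bijections_simps [simp]:
  "f \<in> carrier bijections \<longleftrightarrow> bij f" "f \<otimes>\<^bsub>bijections\<^esub> g = f \<circ> g" "\<one>\<^bsub>bijections\<^esub> = id"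
  by (simp_all add: bijections_def)

lemma group_bijections: "group bijections"
proof (rule groupI)
  fix f :: "'a \<Rightarrow> 'a" assume "f \<in> carrier bijections"
  then show "\<exists>g\<in>carrier bijections. g \<otimes>\<^bsub>bijections\<^esub> f = \<one>\<^bsub>bijections\<^esub>"
    by (intro bexI[of _ "inv_into UNIV f"]) (auto simp: bij_is_inj bij_imp_bij_inv)
qed (auto simp: bij_comp comp_assoc)

interpretation bij: group bijections
  by (rule group_bijections)

lemma pow_bijections: "f [^]\<^bsub>bijections\<^esub> (n::nat) = f ^^ n"
  by (induction n) (simp_all add: funpow_Suc_right del: funpow.simps(2))

text \<open>
  The maps \<open>burau1\<close>, \<open>burau2\<close>, \<open>burau3\<close> are the standard generators of the braid group on four strands,
  in the basis formed by their \<open>z\<close>-eigenvectors and with Burau parameter \<open>-z\<close>; matrices are written as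
  maps of coordinate triples. The maps \<open>burau_a\<close> and \<open>burau_b\<close> are \<open>\<sigma>\<^sub>1 \<sigma>\<^sub>3\<^sup>-\<^sup>1\<close> and its conjugate by \<open>\<sigma>\<^sub>2\<close>,
  multiplied out.
\<close>
definition burau1 :: "'a::field \<Rightarrow> 'a \<times> 'a \<times> 'a \<Rightarrow> 'a \<times> 'a \<times> 'a" where
  "burau1 z = (\<lambda>(x, y, w). (z * x + y, y, w))"

definition burau2 :: "'a::field \<Rightarrow> 'a \<times> 'a \<times> 'a \<Rightarrow> 'a \<times> 'a \<times> 'a" where
  "burau2 z = (\<lambda>(x, y, w). (x, z * (y - x - w), w))"

definition burau3 :: "'a::field \<Rightarrow> 'a \<times> 'a \<times> 'a \<Rightarrow> 'a \<times> 'a \<times> 'a" where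
  "burau3 z = (\<lambda>(x, y, w). (x, y, y + z * w))"

definition burau_a :: "'a::field \<Rightarrow> 'a \<times> 'a \<times> 'a \<Rightarrow> 'a \<times> 'a \<times> 'a" where
  "burau_a z = (\<lambda>(x, y, w). (z * x + y, y, (w - y) / z))"

definition burau_b :: "'a::field \<Rightarrow> 'a \<times> 'a \<times> 'a \<Rightarrow> 'a \<times> 'a \<times> 'a" where
  "burau_b z = (\<lambda>(x, y, w). ((1 + z) * x + y / z + w, (1 - z^2) * x + y / z, - (x / z) - y / z^2))"

context
  fixes z :: "'a::field"
  assumes z: "z \<noteq> 0"
begin

lemma bij_burau:
  "bij (burau1 z)" "bij (burau2 z)" "bij (burau3 z)" "bij (burau_a z)" "bij (burau_b z)"
proof -
  show "bij (burau1 z)"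
    by (rule o_bij[of "\<lambda>(x, y, w). ((x - y) / z, y, w)"]) (use z in \<open>auto simp: burau1_def fun_eq_iff\<close>)
  show "bij (burau2 z)"
    by (rule o_bij[of "\<lambda>(x, y, w). (x, y / z + x + w, w)"]) (use z in \<open>auto simp: burau2_def fun_eq_iff\<close>)
  show "bij (burau3 z)"
    by (rule o_bij[of "\<lambda>(x, y, w). (x, y, (w - y) / z)"]) (use z in \<open>auto simp: burau3_def fun_eq_iff\<close>)
  show "bij (burau_a z)"
    by (rule o_bij[of "\<lambda>(x, y, w). ((x - y) / z, y, y + z * w)"])
      (use z in \<open>auto simp: burau_a_def fun_eq_iff\<close>)
  show "bij (burau_b z)"
    by (rule o_bij[of "\<lambda>(x, y, w). (- (w / z) - y / z^2, (1 - z^2) * w + y / z, (1 + z) * w + y / z + x)"])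
      (use z in \<open>auto simp: burau_b_def fun_eq_iff field_simps power2_eq_square\<close>)
qed

lemma burau_relations:
  "burau1 z \<circ> burau_a z = burau_a z \<circ> burau1 z"
  "burau1 z \<circ> (burau_b z \<circ> burau_a z) = burau_b z \<circ> burau1 z"
  "burau3 z \<circ> burau_a z = burau_a z \<circ> burau3 z"
  "burau3 z \<circ> (burau_a z \<circ> burau_b z) = burau_b z \<circ> burau3 z"
  "burau2 z \<circ> burau1 z \<circ> burau3 z \<circ> burau_a z = burau_b z \<circ> (burau2 z \<circ> burau1 z \<circ> burau3 z)"
  "burau_a z \<circ> (burau2 z \<circ> burau1 z \<circ> burau3 z \<circ> burau_b z) = burau2 z \<circ> burau1 z \<circ> burau3 z"
  using z
  by (auto simp: fun_eq_iff burau1_def burau2_def burau3_def burau_a_def burau_b_def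
      field_simps power2_eq_square)

lemma burau_a_funpow:
  "(burau_a z ^^ n) (x, y, w) =
     (z ^ n * x + (\<Sum>i<n. z ^ i) * y, y, (1 / z) ^ n * w - (\<Sum>i<n. (1 / z) ^ i) * (y / z))"
proof (induction n)
  case (Suc n)
  have shift: "(\<Sum>i<Suc n. u ^ i) = 1 + u * (\<Sum>i<n. u ^ i)" for u :: 'a
    unfolding sum.lessThan_Suc_shift by (simp add: sum_distrib_left)
  define A B q where "A = (\<Sum>i<n. z ^ i)" and "B = (\<Sum>i<n. (1 / z) ^ i)" and "q = (1 / z) ^ n"
  have "(burau_a z ^^ Suc n) (x, y, w) = burau_a z (z ^ n * x + A * y, y, q * w - B * (y / z))"
    using Suc by (simp add: A_def B_def q_def)
  also have "\<dots> = (z ^ Suc n * x + (1 + z * A) * y, y, (1 / z) * q * w - (1 + (1 / z) * B) * (y / z))"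
    using z by (simp add: burau_a_def field_simps)
  finally show ?case
    by (simp only: shift A_def B_def q_def power_Suc)
qed simp

lemma burau_a_funpow_eq_id:
  assumes "z ^ k = 1" "z \<noteq> 1"
  shows "burau_a z ^^ k = id"
proof -
  have "(\<Sum>i<k. u ^ i) = 0" if "u ^ k = 1" "u \<noteq> 1" for u :: 'a
    using that by (simp add: geometric_sum)
  moreover have "(1 / z) ^ k = 1" "1 / z \<noteq> 1"
    using assms by (simp_all add: power_one_over)
  ultimately show ?thesis
    using assms by (auto simp: fun_eq_iff burau_a_funpow)
qed

end

section \<open>An element of infinite order\<close>

text \<open>
  Let \<open>M\<close> be the image of \<open>abba\<close>. It has the characteristic polynomial \<open>(X - 1) (X\<^sup>2 - s X + 1)\<close> with
  \<open>s = 2 + z + z\<^sup>-\<^sup>1 - z\<^sup>3 - z\<^sup>-\<^sup>3\<close>. The vector below is \<open>e + (1 + z) (p M w + q w)\<close>, where \<open>e = (0, 0, z\<^sup>3)\<close> and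
  \<open>w = (z\<^sup>2, z\<^sup>2 - z\<^sup>3, -1)\<close> is chosen such that \<open>(M - 1) e = (1 + z) w\<close>. As \<open>w\<close> lies in the image of \<open>M - 1\<close>
  for \<open>z \<noteq> -1\<close>, it satisfies \<open>M\<^sup>2 w = s M w - w\<close>, so that \<open>M\<close> acts on the coordinates \<open>(p, q)\<close> by an
  affine map, with real coefficients if \<open>s\<close> is real. Starting at \<open>e\<close> instead of \<open>w\<close> matters for
  \<open>z\<^sup>4 = 1\<close>, when \<open>M w = w\<close>.
\<close>
definition orbit_vector :: "complex \<Rightarrow> complex \<Rightarrow> complex \<Rightarrow> complex \<times> complex \<times> complex" where
  "orbit_vector z p q =
     ((1 + z) * (p * (- 1 / z + z^2 + z^3) + q * z^2),
      (1 + z) * (p * (- 1 / z + 1 + z + z^2 - z^4 - z^5) + q * (z^2 - z^3)),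
      z^3 + (1 + z) * (p * (1 / z^3 - 1 / z - 2 - z + z^3 + z^4) - q))"

lemma burau_abba:
  assumes z: "z \<noteq> 0"
  shows "(burau_a z \<circ> burau_b z \<circ> burau_b z \<circ> burau_a z) (orbit_vector z p q) =
    orbit_vector z ((2 + (z + 1 / z) * (4 - (z + 1 / z)^2)) * p + q) (1 - p)"
proof -
  \<comment> \<open>With \<open>1 / z\<close> as a second variable the claim is an identity of polynomials modulo \<open>y * z = 1\<close>;
    the name \<open>y\<close> puts the two variables next to each other in the term order of the simplifier.\<close>
  define y where "y = 1 / z"
  have y: "y * z = 1" "\<And>u. y * (z * u) = u"
    using z by (simp_all add: y_def)
  have div: "u / z = u * y" "u / z ^ 3 = u * y ^ 3" "u / z ^ 2 = u * y ^ 2" for u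
    by (simp_all add: y_def power_one_over divide_simps)
  show ?thesis
    unfolding burau_a_def burau_b_def orbit_vector_def comp_def prod.case prod.inject div
    by (simp add: algebra_simps power_numeral_reduce y)
qed

lemma infinite_quotient:
  assumes "k \<ge> 4"
  shows "infinite (carrier (F2 Mod primitive_power_subgroup k))"
proof
  assume fin: "finite (carrier (F2 Mod primitive_power_subgroup k))"
  define \<theta> where "\<theta> = 2 * pi / real k"
  define z where "z = cis \<theta>"
  have \<theta>: "0 < \<theta>" "\<theta> \<le> pi / 2"
    using assms by (simp_all add: \<theta>_def field_simps)
  have z0: "z \<noteq> 0" by (simp add: z_def)
  have zk: "z ^ k = 1"
    using assms by (simp add: z_def DeMoivre \<theta>_def)
  have "cos \<theta> < cos 0"
    using \<theta> pi_gt_zero by (intro cos_monotone_0_pi) linarith+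
  then have z1: "z \<noteq> 1"
    by (auto simp: z_def complex_eq_iff)
  define s where "s = 2 + 2 * cos \<theta> * (4 - (2 * cos \<theta>)^2)"
  have "cos \<theta> \<ge> 0" using \<theta> by (intro cos_ge_zero) auto
  moreover have "(cos \<theta>)^2 \<le> 1" by (simp add: abs_square_le_1)
  ultimately have s: "s \<ge> 2"
    by (simp add: s_def power_mult_distrib)
  have "z + 1 / z = complex_of_real (2 * cos \<theta>)"
    by (simp add: z_def complex_eq_iff cis_inverse flip: inverse_eq_divide)
  then have s_eq: "2 + (z + 1 / z) * (4 - (z + 1 / z)^2) = complex_of_real s"
    by (simp add: s_def)

  define a where "a = burau_a z"
  define b where "b = burau_b z"
  let ?x = "[(True, True)] :: (bool \<times> bool) list" and ?y = "[(False, True)] :: (bool \<times> bool) list"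
  have bij [simp]: "bij a" "bij b" "bij (burau1 z)" "bij (burau2 z)" "bij (burau3 z)"
    using bij_burau[OF z0] by (simp_all add: a_def b_def)
  obtain h where hom: "h \<in> hom F2 bijections" and h: "h ?x = a" "h ?y = b"
    using free_group_universal[OF group_bijections, of "\<lambda>i. if i then a else b" UNIV] by auto
  interpret h: group_hom F2 bijections h
    by unfold_locales (rule hom)
  define r where "r = burau2 z \<circ> burau1 z \<circ> burau3 z"
  have r [simp]: "bij r" by (simp add: r_def bij_comp)
  have rel: "burau1 z \<circ> a = a \<circ> burau1 z" "burau1 z \<circ> (b \<circ> a) = b \<circ> burau1 z"
    "burau3 z \<circ> a = a \<circ> burau3 z" "burau3 z \<circ> (a \<circ> b) = b \<circ> burau3 z"
    "r \<circ> a = b \<circ> r" "a \<circ> (r \<circ> b) = r"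
    unfolding a_def b_def r_def by (fact burau_relations[OF z0])+
  have "bij.conjugate r b = m_inv bijections a"
  proof (rule bij.conjugate_eqI)
    show "r \<otimes>\<^bsub>bijections\<^esub> b = m_inv bijections a \<otimes>\<^bsub>bijections\<^esub> r"
      using rel(6) by (subst bij.inv_solve_left) (simp_all add: bij_comp)
  qed (use bij.inv_closed[of a] in auto)
  moreover have "bij.conjugate (burau1 z) a = a" "bij.conjugate (burau1 z) (b \<circ> a) = b"
    "bij.conjugate (burau3 z) a = a" "bij.conjugate (burau3 z) (a \<circ> b) = b"
    "bij.conjugate r a = b"
    by (rule bij.conjugate_eqI; simp add: rel bij_comp)+
  moreover have "a [^]\<^bsub>bijections\<^esub> k = id"
    using burau_a_funpow_eq_id[OF z0 zk z1] by (simp add: pow_bijections a_def)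
  ultimately have kill: "h (x [^]\<^bsub>F2\<^esub> k) = id" if "x \<in> primitive_elements" for x
    using bij.primitive_power_eq_one[OF hom h, of "burau1 z" "burau3 z" r k x] that by simp
  define N where "N = primitive_power_subgroup k"
  have N: "N \<subseteq> kernel F2 bijections h"
    unfolding N_def primitive_power_subgroup_def using kill primitive_elements_carrier
    by (intro F2.generate_subgroup_incl h.subgroup_kernel) (auto simp: kernel_def)
  interpret N: normal N F2
    unfolding N_def by (rule normal_primitive_power_subgroup)
  interpret Q: group "F2 Mod N"
    by (rule N.factorgroup_is_group)

  define w where "w = ?x \<otimes>\<^bsub>F2\<^esub> ?y \<otimes>\<^bsub>F2\<^esub> ?y \<otimes>\<^bsub>F2\<^esub> ?x"
  have xy: "?x \<in> carrier F2" "?y \<in> carrier F2"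
    by (simp_all add: letter_in_carrier)
  then have w: "w \<in> carrier F2" by (simp add: w_def)
  define M where "M = a \<circ> b \<circ> b \<circ> a"
  have hw: "h w = M" using xy by (simp add: w_def M_def h)
  obtain n where n: "order (F2 Mod N) = Suc n"
    using fin Q.order_gt_0_iff_finite gr0_implies_Suc unfolding N_def by blast
  have "(N #>\<^bsub>F2\<^esub> w) [^]\<^bsub>F2 Mod N\<^esub> Suc n = \<one>\<^bsub>F2 Mod N\<^esub>"
    using Q.pow_order_eq_1[of "N #>\<^bsub>F2\<^esub> w"] w unfolding n carrier_FactGroup by blast
  then have "N #>\<^bsub>F2\<^esub> (w [^]\<^bsub>F2\<^esub> Suc n) = N"
    by (simp only: N.FactGroup_pow[OF w] one_FactGroup)
  then have "w [^]\<^bsub>F2\<^esub> Suc n \<in> N"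
    using F2.coset_join1[OF _ F2.nat_pow_closed[OF w] N.subgroup_axioms] by blast
  then have "M ^^ Suc n = id"
    using N h.hom_nat_pow[OF w, of "Suc n"] hw pow_bijections[of M "Suc n"]
    by (auto simp: kernel_def)
  \<comment> \<open>In the step \<open>p + q\<close> becomes \<open>(s - 1) p + q + 1\<close>, which is at least \<open>p + q + 1\<close> because \<open>s \<ge> 2\<close>.\<close>
  have orbit: "\<exists>p q :: real. (M ^^ n) (orbit_vector z 0 0) = orbit_vector z (of_real p) (of_real q) \<and>
      p \<ge> 0 \<and> p + q \<ge> real n" for n
  proof (induction n)
    case 0
    show ?case by (intro exI[of _ 0]) simp
  next
    case (Suc n)
    then obtain p q :: real
      where pq: "(M ^^ n) (orbit_vector z 0 0) = orbit_vector z (of_real p) (of_real q)"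
        "p \<ge> 0" "p + q \<ge> real n" by blast
    have "(M ^^ Suc n) (orbit_vector z 0 0) = M (orbit_vector z (of_real p) (of_real q))"
      by (simp add: pq(1))
    also have "\<dots> = orbit_vector z (of_real (s * p + q)) (of_real (1 - p))"
      using burau_abba[OF z0, of "of_real p" "of_real q"] s_eq by (simp add: M_def a_def b_def)
    finally show ?case
      using pq(2,3) mult_right_mono[OF s pq(2)]
      by (intro exI[of _ "s * p + q"] exI[of _ "1 - p"]) auto
  qed
  obtain p q :: real where fixed: "orbit_vector z 0 0 = orbit_vector z (of_real p) (of_real q)"
    and pq: "p + q \<ge> real (Suc n)"
    using orbit[of "Suc n"] \<open>M ^^ Suc n = id\<close> by (metis id_apply)
  \<comment> \<open>A linear form that vanishes on \<open>e\<close> and takes the same value on \<open>w\<close> and \<open>M w\<close>, so that it reads off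
    \<open>p + q\<close>.\<close>
  define f where "f = (\<lambda>(x, y, w :: complex). (z^2 + z - 1) * x + y)"
  have f: "f (orbit_vector z p q) = (1 + z) * z^4 * (p + q)" for p q
    using z0 by (simp add: f_def orbit_vector_def field_simps power_numeral_reduce)
  have "1 + z \<noteq> 0"
    using \<open>cos \<theta> \<ge> 0\<close> by (auto simp: z_def complex_eq_iff)
  moreover have "(1 + z) * z^4 * of_real (p + q) = 0"
    using arg_cong[OF fixed, of f] unfolding f by simp
  ultimately have "p + q = 0" using z0 by (simp del: of_real_add)
  then show False using pq by simp
qed

theorem mainTheorem1:
  fixes k :: nat
  assumes "k > 0"
  shows "finite (carrier (F2 Mod primitive_power_subgroup k)) \<longleftrightarrow> k \<in> {1, 2, 3}"
proof -
  have "k \<in> {1, 2, 3} \<or> k \<ge> 4" using assms by auto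
  then show ?thesis using finite_quotient infinite_quotient by auto
qed

end
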